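(* Let $A$ be a regular weak multiplier bialgebra over a field $k$ and let $(V,\lambda,\varrho)$ be a finite dimensional right $A$-comodule. Let $\{a_i\}$ be a basis of $A$ with dual basis (coordinate functionals) $\{\alpha_i\}$ in $A^*=\mathsf{Lin}(A,k)$. Then the dual vector space $V^*=\mathsf{Lin}(V,k)$ carries a left $A$-comodule structure $$\lambda^*:A\otimes V^*\to A\otimes V^*,\qquad b\otimes\varphi\mapsto\sum_ia_i\otimes(\varphi\otimes\alpha_i)\lambda(-\otimes b),$$ $$\varrho^*:A\otimes V^*\to A\otimes V^*,\qquad b\otimes\varphi\mapsto\sum_ia_i\otimes(\varphi\otimes\alpha_i)\varrho(-\otimes b).$$
   Context: Conventions. All vector spaces are over a field $k$; $\otimes$ is $\otimes_k$; the identity map of a space $V$ is also denoted by $V$; composition is juxtaposition; $\mathsf{Lin}(V,W)$ is the space of linear maps; $\mathsf{tw}$ is the flip; $\langle\ldots\rangle$ denotes linear span. For a linear map $f:V\otimes W\to V'\otimes W'$ put $f^{13}=(V'\otimes\mathsf{tw})(f\otimes Z)(V\otimes\mathsf{tw}):V\otimes Z\otimes W\to V'\otimes Z\otimes W'$ for any space $Z$. An associative, possibly non-unital algebra $A$ with multiplication $\mu$ is idempotent if $\mu:A\otimes A\to A$ is surjective, and non-degenerate if each of ($ab=0\ \forall b\in A$) and ($ba=0\ \forall b\in A$) implies $a=0$. A regular weak multiplier bialgebra is an idempotent non-degenerate $k$-algebra $A$ with linear maps $E_1,E_2,T_1,T_2,T_3,T_4:A\otimes A\to A\otimes A$ and $\epsilon:A\to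 k$ such that for all $a,b,c,d\in A$: (i) $(a\otimes b)E_1(c\otimes d)=E_2(a\otimes b)(c\otimes d)$; (ii) $E_1^2=E_1$; (iii) $(T_2\otimes A)(A\otimes T_1)=(A\otimes T_1)(T_2\otimes A)$; (iv) $(\epsilon\otimes A)T_1=\mu=(A\otimes\epsilon)T_2$; (v) $(\mu\otimes A)T_1^{13}(A\otimes T_1)=T_1(\mu\otimes A)$; (vi) $\langle T_1(a\otimes c)(b\otimes 1)\mid a,b,c\in A\rangle=\langle E_1(b\otimes c)\mid b,c\in A\rangle$ and $\langle(1\otimes c)T_2(b\otimes a)\mid a,b,c\in A\rangle=\langle E_2(b\otimes c)\mid b,c\in A\rangle$; (vii) $(E_1\otimes A)(A\otimes T_1)=(A\otimes T_1)(E_1\otimes A)$ and $(E_2\otimes A)(A\otimes T_2)=(A\otimes T_2)E_2^{13}$; (viii) $(\epsilon\otimes A)((1\otimes a)E_1(b\otimes c))=(\epsilon\otimes A)(T_1(a\otimes c)(b\otimes1))$ and $(\epsilon\otimes A)(E_2(a\otimes b)(1\otimes c))=(\epsilon\otimes A)((1\otimes b)T_2(a\otimes c))$; (ix) $(1\otimes a)T_1(c\otimes b)=T_3(c\otimes a)(1\otimes b)$ and $T_2(a\otimes c)(b\otimes1)=(a\otimes1)T_4(b\otimes c)$. (Here $(x\otimes 1)(y\otimes z)=xy\otimes z$, etc.) A right $A$-comodule is a vector space $V$ with linear maps $\lambda,\varrho:V\otimes A\to V\otimes A$ such that $(1\otimes a)\lambda(v\otimes b)=\varrho(v\otimes a)(1\otimes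 b)$ for all $v\in V$, $a,b\in A$ (where $(1\otimes a)(v\otimes b)=v\otimes ab$, $(v\otimes b)(1\otimes a)=v\otimes ba$), $(\lambda\otimes A)\lambda^{13}(V\otimes E_1)=(\lambda\otimes A)\lambda^{13}$ and $(\lambda\otimes A)\lambda^{13}(V\otimes T_1)=(V\otimes T_1)(\lambda\otimes A)$. A left $A$-comodule is a vector space $V$ with linear maps $\lambda,\varrho:A\otimes V\to A\otimes V$ such that $(a\otimes1)\lambda(b\otimes v)=\varrho(a\otimes v)(b\otimes1)$ for all $v\in V$, $a,b\in A$, $(A\otimes\lambda)\lambda^{13}(E_1\otimes V)=(A\otimes\lambda)\lambda^{13}$ and $(A\otimes\lambda)\lambda^{13}(T_1\otimes V)=(T_1\otimes V)\lambda^{13}$. The expression $(\varphi\otimes\alpha_i)\lambda(-\otimes b)$ denotes the functional $v\mapsto(\varphi\otimes\alpha_i)(\lambda(v\otimes b))$ on $V$; that the (possibly infinite) index set yields only finitely many non-zero summands is part of the assertion that the maps are meaningful. *)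

theory Defs
  imports "HOL-Algebra.AbelCoset" "Jordan_Normal_Form.Missing_VectorSpace"
begin

text \<open>
  Vector spaces are the carrier-based ones of the locale \<open>vectorspace\<close>, linear maps are the
  elements of \<open>module_hom\<close>. Maps are only relevant on carriers, so equations between maps are
  stated elementwise.
\<close>

section \<open>The ground field as a space, dual spaces, free spaces and quotients\<close>

abbreviation lin_span :: "('k, 'm) ring_scheme \<Rightarrow> ('k, 'v, 'n) module_scheme \<Rightarrow> 'v set \<Rightarrow> 'v set" where
  "lin_span \<equiv> module.span"

definition self_module :: "('k, 'm) ring_scheme \<Rightarrow> ('k, 'k) module" where
  "self_module K = \<lparr>carrier = carrier K, mult = mult K, one = one K, zero = zero K, add = add K,
     smult = mult K\<rparr>"

text \<open>Functionals are required to be extensional, so that each one has a unique representative.\<close>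

definition dual_space :: "('k, 'm) ring_scheme \<Rightarrow> ('k, 'v, 'n) module_scheme
    \<Rightarrow> ('k, 'v \<Rightarrow> 'k) module" where
  "dual_space K V = (ring.func_space K (carrier V))
     \<lparr>carrier := module_hom K V (self_module K) \<inter> extensional (carrier V)\<rparr>"

definition free_space :: "('k, 'm) ring_scheme \<Rightarrow> 's set \<Rightarrow> ('k, 's \<Rightarrow> 'k) module" where
  "free_space K S = (ring.func_space K S)
     \<lparr>carrier := {p \<in> S \<rightarrow>\<^sub>E carrier K. finite {s \<in> S. p s \<noteq> \<zero>\<^bsub>K\<^esub>}}\<rparr>"

definition free_gen :: "('k, 'm) ring_scheme \<Rightarrow> 's set \<Rightarrow> 's \<Rightarrow> 's \<Rightarrow> 'k" where
  "free_gen K S s = (\<lambda>t\<in>S. if t = s then \<one>\<^bsub>K\<^esub> else \<zero>\<^bsub>K\<^esub>)"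

text \<open>The fields \<open>mult\<close> and \<open>one\<close> of a \<open>module\<close> record play no role for a mere vector space.\<close>

definition quotient_space :: "('k, 'v, 'n) module_scheme \<Rightarrow> 'v set \<Rightarrow> ('k, 'v set) module" where
  "quotient_space M N = \<lparr>carrier = a_rcosets\<^bsub>M\<^esub> N, mult = undefined, one = undefined,
     zero = N, add = set_add M,
     smult = (\<lambda>c X. \<Union>x\<in>X. N +>\<^bsub>M\<^esub> (c \<odot>\<^bsub>M\<^esub> x))\<rparr>"


section \<open>Tensor products\<close>

definition tensor_rels :: "('k, 'm) ring_scheme \<Rightarrow> ('k, 'v, 'n) module_scheme
    \<Rightarrow> ('k, 'w, 'l) module_scheme \<Rightarrow> ('v \<times> 'w \<Rightarrow> 'k) set" where
  "tensor_rels K V W =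
    (let S = carrier V \<times> carrier W; F = free_space K S; g = (\<lambda>v w. free_gen K S (v, w)) in
       {g (v \<oplus>\<^bsub>V\<^esub> v') w \<ominus>\<^bsub>F\<^esub> (g v w \<oplus>\<^bsub>F\<^esub> g v' w) | v v' w.
          v \<in> carrier V \<and> v' \<in> carrier V \<and> w \<in> carrier W}
     \<union> {g v (w \<oplus>\<^bsub>W\<^esub> w') \<ominus>\<^bsub>F\<^esub> (g v w \<oplus>\<^bsub>F\<^esub> g v w') | v w w'.
          v \<in> carrier V \<and> w \<in> carrier W \<and> w' \<in> carrier W}
     \<union> {g (c \<odot>\<^bsub>V\<^esub> v) w \<ominus>\<^bsub>F\<^esub> (c \<odot>\<^bsub>F\<^esub> g v w) | c v w.
          c \<in> carrier K \<and> v \<in> carrier V \<and> w \<in> carrier W}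
     \<union> {g v (c \<odot>\<^bsub>W\<^esub> w) \<ominus>\<^bsub>F\<^esub> (c \<odot>\<^bsub>F\<^esub> g v w) | c v w.
          c \<in> carrier K \<and> v \<in> carrier V \<and> w \<in> carrier W})"

definition tensor_space :: "('k, 'm) ring_scheme \<Rightarrow> ('k, 'v, 'n) module_scheme
    \<Rightarrow> ('k, 'w, 'l) module_scheme \<Rightarrow> ('k, ('v \<times> 'w \<Rightarrow> 'k) set) module" where
  "tensor_space K V W =
    (let F = free_space K (carrier V \<times> carrier W)
      in quotient_space F (lin_span K F (tensor_rels K V W)))"

definition tensor :: "('k, 'm) ring_scheme \<Rightarrow> ('k, 'v, 'n) module_scheme
    \<Rightarrow> ('k, 'w, 'l) module_scheme \<Rightarrow> 'v \<Rightarrow> 'w \<Rightarrow> ('v \<times> 'w \<Rightarrow> 'k) set" where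
  "tensor K V W v w =
    (let S = carrier V \<times> carrier W; F = free_space K S
      in lin_span K F (tensor_rels K V W) +>\<^bsub>F\<^esub> free_gen K S (v, w))"

text \<open>\<open>tensor_lift K V W U f\<close> is the linear map \<open>V \<otimes> W \<rightarrow> U\<close> induced by the bilinear map \<open>f\<close>.\<close>

definition tensor_lift :: "('k, 'm) ring_scheme \<Rightarrow> ('k, 'v, 'n) module_scheme
    \<Rightarrow> ('k, 'w, 'l) module_scheme \<Rightarrow> ('k, 'u, 'j) module_scheme \<Rightarrow> ('v \<Rightarrow> 'w \<Rightarrow> 'u)
    \<Rightarrow> ('v \<times> 'w \<Rightarrow> 'k) set \<Rightarrow> 'u" where
  "tensor_lift K V W U f =
    (THE h. h \<in> module_hom K (tensor_space K V W) U
       \<and> h \<in> extensional (carrier (tensor_space K V W))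
       \<and> (\<forall>v\<in>carrier V. \<forall>w\<in>carrier W. h (tensor K V W v w) = f v w))"

subsection \<open>The universal property\<close>

text \<open>This shows that the definite description in \<open>tensor_lift\<close> is well-defined.\<close>

definition bilinear_map :: "('k, 'm) ring_scheme \<Rightarrow> ('k, 'v, 'n) module_scheme
    \<Rightarrow> ('k, 'w, 'l) module_scheme \<Rightarrow> ('k, 'u, 'j) module_scheme \<Rightarrow> ('v \<Rightarrow> 'w \<Rightarrow> 'u) \<Rightarrow> bool" where
  "bilinear_map K V W U f \<longleftrightarrow>
     (\<forall>v\<in>carrier V. \<forall>w\<in>carrier W. f v w \<in> carrier U)
   \<and> (\<forall>v\<in>carrier V. \<forall>v'\<in>carrier V. \<forall>w\<in>carrier W. f (v \<oplus>\<^bsub>V\<^esub> v') w = f v w \<oplus>\<^bsub>U\<^esub> f v' w)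
   \<and> (\<forall>v\<in>carrier V. \<forall>w\<in>carrier W. \<forall>w'\<in>carrier W. f v (w \<oplus>\<^bsub>W\<^esub> w') = f v w \<oplus>\<^bsub>U\<^esub> f v w')
   \<and> (\<forall>c\<in>carrier K. \<forall>v\<in>carrier V. \<forall>w\<in>carrier W. f (c \<odot>\<^bsub>V\<^esub> v) w = c \<odot>\<^bsub>U\<^esub> f v w)
   \<and> (\<forall>c\<in>carrier K. \<forall>v\<in>carrier V. \<forall>w\<in>carrier W. f v (c \<odot>\<^bsub>W\<^esub> w) = c \<odot>\<^bsub>U\<^esub> f v w)"

lemma module_free_space:
  assumes "cring K" shows "module K (free_space K S)"
proof -
  interpret K: cring K by fact
  interpret F: module K "K.func_space S" by (rule K.func_space_is_module)
  have "submodule K {p \<in> S \<rightarrow>\<^sub>E carrier K. finite {s \<in> S. p s \<noteq> \<zero>\<^bsub>K\<^esub>}} (K.func_space S)"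
  proof
    show "{p \<in> S \<rightarrow>\<^sub>E carrier K. finite {s \<in> S. p s \<noteq> \<zero>\<^bsub>K\<^esub>}} \<subseteq> carrier (K.func_space S)"
      by (auto simp: K.func_space_def)
  next
    fix v w assume vw: "v \<in> {p \<in> S \<rightarrow>\<^sub>E carrier K. finite {s \<in> S. p s \<noteq> \<zero>\<^bsub>K\<^esub>}}"
      "w \<in> {p \<in> S \<rightarrow>\<^sub>E carrier K. finite {s \<in> S. p s \<noteq> \<zero>\<^bsub>K\<^esub>}}"
    have "{s \<in> S. (v \<oplus>\<^bsub>K.func_space S\<^esub> w) s \<noteq> \<zero>\<^bsub>K\<^esub>} \<subseteq> {s \<in> S. v s \<noteq> \<zero>\<^bsub>K\<^esub>} \<union> {s \<in> S. w s \<noteq> \<zero>\<^bsub>K\<^esub>}"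
      using vw by (auto simp: K.func_space_def)
    moreover have "finite ({s \<in> S. v s \<noteq> \<zero>\<^bsub>K\<^esub>} \<union> {s \<in> S. w s \<noteq> \<zero>\<^bsub>K\<^esub>})" using vw by auto
    ultimately have "finite {s \<in> S. (v \<oplus>\<^bsub>K.func_space S\<^esub> w) s \<noteq> \<zero>\<^bsub>K\<^esub>}"
      by (rule finite_subset)
    moreover have "v \<oplus>\<^bsub>K.func_space S\<^esub> w \<in> carrier (K.func_space S)"
      using vw by (intro F.M.a_closed) (auto simp: K.func_space_def)
    ultimately show "v \<oplus>\<^bsub>K.func_space S\<^esub> w \<in> {p \<in> S \<rightarrow>\<^sub>E carrier K. finite {s \<in> S. p s \<noteq> \<zero>\<^bsub>K\<^esub>}}"
      by (auto simp: K.func_space_def)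
  next
    show "\<zero>\<^bsub>K.func_space S\<^esub> \<in> {p \<in> S \<rightarrow>\<^sub>E carrier K. finite {s \<in> S. p s \<noteq> \<zero>\<^bsub>K\<^esub>}}"
      by (auto simp: K.func_space_def)
  next
    fix c v assume c: "c \<in> carrier K" and v: "v \<in> {p \<in> S \<rightarrow>\<^sub>E carrier K. finite {s \<in> S. p s \<noteq> \<zero>\<^bsub>K\<^esub>}}"
    have "{s \<in> S. (c \<odot>\<^bsub>K.func_space S\<^esub> v) s \<noteq> \<zero>\<^bsub>K\<^esub>} \<subseteq> {s \<in> S. v s \<noteq> \<zero>\<^bsub>K\<^esub>}"
      using c by (auto simp: K.func_space_def)
    then have "finite {s \<in> S. (c \<odot>\<^bsub>K.func_space S\<^esub> v) s \<noteq> \<zero>\<^bsub>K\<^esub>}"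
      using v by (auto intro: finite_subset)
    moreover have "c \<odot>\<^bsub>K.func_space S\<^esub> v \<in> carrier (K.func_space S)"
      using v c by (intro F.smult_closed) (auto simp: K.func_space_def)
    ultimately show "c \<odot>\<^bsub>K.func_space S\<^esub> v \<in> {p \<in> S \<rightarrow>\<^sub>E carrier K. finite {s \<in> S. p s \<noteq> \<zero>\<^bsub>K\<^esub>}}"
      by (auto simp: K.func_space_def)
  qed
  from F.submodule_is_module[OF this] show ?thesis by (simp add: free_space_def)
qed

lemma free_gen_closed:
  assumes "cring K" "s \<in> S" shows "free_gen K S s \<in> carrier (free_space K S)"
proof -
  interpret K: cring K by fact
  have "{t \<in> S. free_gen K S s t \<noteq> \<zero>\<^bsub>K\<^esub>} \<subseteq> {s}" by (auto simp: free_gen_def)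
  then have "finite {t \<in> S. free_gen K S s t \<noteq> \<zero>\<^bsub>K\<^esub>}" by (rule finite_subset) simp
  then show ?thesis by (auto simp: free_space_def free_gen_def)
qed

lemma submodule_subgroup:
  assumes "module K M" "submodule K N M"
  shows "subgroup N (add_monoid M)"
proof -
  interpret M: module K M by fact
  interpret N: submodule K N M by fact
  have "\<ominus>\<^bsub>M\<^esub> x \<in> N" if "x \<in> N" for x
  proof -
    have "x \<in> carrier M" using that N.subset by auto
    then have "\<ominus>\<^bsub>M\<^esub> x = (\<ominus>\<^bsub>K\<^esub> \<one>\<^bsub>K\<^esub>) \<odot>\<^bsub>M\<^esub> x" by (simp add: M.smult_l_minus)
    then show ?thesis using that by simp
  qed
  then show ?thesis
    using N.subset by unfold_locales (auto simp: a_inv_def)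
qed

lemma module_quotient_space:
  assumes "module K M" "submodule K N M"
  shows "module K (quotient_space M N)"
    and "(\<lambda>x. N +>\<^bsub>M\<^esub> x) \<in> module_hom K M (quotient_space M N)"
    and "carrier (quotient_space M N) = (\<lambda>x. N +>\<^bsub>M\<^esub> x) ` carrier M"
proof -
  interpret M: module K M by fact
  interpret N: submodule K N M by fact
  have "subgroup N (add_monoid M)" by (rule submodule_subgroup[OF assms])
  then interpret N': abelian_subgroup N M
    using M.M.abelian_group_axioms additive_subgroup.intro abelian_subgroupI3 by blast
  let ?Q = "quotient_space M N"
  show car: "carrier ?Q = (\<lambda>x. N +>\<^bsub>M\<^esub> x) ` carrier M"
    by (auto simp: quotient_space_def A_RCOSETS_def' )
  have add: "(N +>\<^bsub>M\<^esub> x) \<oplus>\<^bsub>?Q\<^esub> (N +>\<^bsub>M\<^esub> y) = N +>\<^bsub>M\<^esub> (x \<oplus>\<^bsub>M\<^esub> y)"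
    if "x \<in> carrier M" "y \<in> carrier M" for x y
    using that by (simp add: quotient_space_def N'.a_rcos_sum)
  have smult: "c \<odot>\<^bsub>?Q\<^esub> (N +>\<^bsub>M\<^esub> x) = N +>\<^bsub>M\<^esub> (c \<odot>\<^bsub>M\<^esub> x)"
    if c: "c \<in> carrier K" and x: "x \<in> carrier M" for c x
  proof -
    have "N +>\<^bsub>M\<^esub> (c \<odot>\<^bsub>M\<^esub> y) = N +>\<^bsub>M\<^esub> (c \<odot>\<^bsub>M\<^esub> x)" if y: "y \<in> N +>\<^bsub>M\<^esub> x" for y
    proof -
      from y obtain n where n: "n \<in> N" "y = n \<oplus>\<^bsub>M\<^esub> x" by (auto simp: a_r_coset_def')
      then have nM: "n \<in> carrier M" using N.subset by auto
      have "c \<odot>\<^bsub>M\<^esub> y = c \<odot>\<^bsub>M\<^esub> n \<oplus>\<^bsub>M\<^esub> c \<odot>\<^bsub>M\<^esub> x" using n nM c x by (simp add: M.smult_r_distr)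
      then have "c \<odot>\<^bsub>M\<^esub> y \<in> N +>\<^bsub>M\<^esub> (c \<odot>\<^bsub>M\<^esub> x)"
        using n c N.smult_closed[of c n] by (auto simp: a_r_coset_def')
      then show ?thesis using c x
        using M.M.a_repr_independence N'.a_subgroup by (metis M.smult_closed)
    qed
    moreover have "x \<in> N +>\<^bsub>M\<^esub> x" using x by (rule N'.a_rcos_self)
    ultimately have "(\<Union>y\<in>N +>\<^bsub>M\<^esub> x. N +>\<^bsub>M\<^esub> (c \<odot>\<^bsub>M\<^esub> y)) = N +>\<^bsub>M\<^esub> (c \<odot>\<^bsub>M\<^esub> x)"
      by blast
    then show ?thesis by (simp add: quotient_space_def)
  qed
  have zero: "\<zero>\<^bsub>?Q\<^esub> = N +>\<^bsub>M\<^esub> \<zero>\<^bsub>M\<^esub>"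
    using N.subset by (simp add: quotient_space_def)
  show "module K ?Q"
  proof (rule module_criteria)
    show "cring K" by (rule M.R.cring_axioms)
    show "\<zero>\<^bsub>?Q\<^esub> \<in> carrier ?Q" unfolding car zero by auto
    show "\<forall>v\<in>carrier ?Q. \<exists>neg_v\<in>carrier ?Q. v \<oplus>\<^bsub>?Q\<^esub> neg_v = \<zero>\<^bsub>?Q\<^esub>"
    proof
      fix v assume "v \<in> carrier ?Q"
      then obtain x where x: "x \<in> carrier M" "v = N +>\<^bsub>M\<^esub> x" unfolding car by auto
      show "\<exists>neg_v\<in>carrier ?Q. v \<oplus>\<^bsub>?Q\<^esub> neg_v = \<zero>\<^bsub>?Q\<^esub>"
        by (rule bexI[of _ "N +>\<^bsub>M\<^esub> (\<ominus>\<^bsub>M\<^esub> x)"]) (use x in \<open>auto simp: car add zero M.M.r_neg\<close>)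
    qed
  next
    show "\<forall>v w. v \<in> carrier ?Q \<and> w \<in> carrier ?Q \<longrightarrow> v \<oplus>\<^bsub>?Q\<^esub> w = w \<oplus>\<^bsub>?Q\<^esub> v"
      unfolding car by (auto simp: add M.M.a_comm)
    show "\<forall>v w x. v \<in> carrier ?Q \<and> w \<in> carrier ?Q \<and> x \<in> carrier ?Q
        \<longrightarrow> v \<oplus>\<^bsub>?Q\<^esub> w \<oplus>\<^bsub>?Q\<^esub> x = v \<oplus>\<^bsub>?Q\<^esub> (w \<oplus>\<^bsub>?Q\<^esub> x)"
      unfolding car by (auto simp: add M.M.a_assoc)
  qed (auto simp: car zero add smult M.smult_assoc1 M.smult_l_distr M.smult_r_distr)
  show "(\<lambda>x. N +>\<^bsub>M\<^esub> x) \<in> module_hom K M ?Q"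
    by (auto simp: module_hom_def car add smult)
qed

lemma free_space_simps:
  "p \<in> carrier (free_space K S) \<longleftrightarrow> p \<in> S \<rightarrow>\<^sub>E carrier K \<and> finite {s \<in> S. p s \<noteq> \<zero>\<^bsub>K\<^esub>}"
  by (auto simp: free_space_def)

lemma free_space_ops:
  assumes "ring K"
  shows "add (free_space K S) f g = (\<lambda>v\<in>S. f v \<oplus>\<^bsub>K\<^esub> g v)"
    "smult (free_space K S) c f = (\<lambda>v\<in>S. c \<otimes>\<^bsub>K\<^esub> f v)"
    "zero (free_space K S) = (\<lambda>v\<in>S. \<zero>\<^bsub>K\<^esub>)"
  using assms by (simp_all add: free_space_def ring.func_space_def)

lemma free_induct:
  assumes K: "cring K" and p: "p \<in> carrier (free_space K S)"
    and zero: "P \<zero>\<^bsub>free_space K S\<^esub>"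
    and step: "\<And>c s q. c \<in> carrier K \<Longrightarrow> s \<in> S \<Longrightarrow> q \<in> carrier (free_space K S) \<Longrightarrow> P q
      \<Longrightarrow> P (c \<odot>\<^bsub>free_space K S\<^esub> free_gen K S s \<oplus>\<^bsub>free_space K S\<^esub> q)"
  shows "P p"
proof -
  interpret K: cring K by fact
  let ?F = "free_space K S"
  have "finite T \<Longrightarrow> \<forall>p. p \<in> carrier ?F \<and> {s \<in> S. p s \<noteq> \<zero>\<^bsub>K\<^esub>} = T \<longrightarrow> P p" for T
  proof (induction T rule: finite_induct)
    case empty
    show ?case
    proof (intro allI impI)
      fix p assume a: "p \<in> carrier ?F \<and> {s \<in> S. p s \<noteq> \<zero>\<^bsub>K\<^esub>} = {}"
      then have "p = \<zero>\<^bsub>?F\<^esub>"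
        by (auto simp: free_space_ops[OF K.ring_axioms] free_space_simps PiE_iff extensional_def fun_eq_iff restrict_def)
      then show "P p" using zero by simp
    qed
  next
    case (insert t T)
    show ?case
    proof (intro allI impI)
      fix p assume a: "p \<in> carrier ?F \<and> {s \<in> S. p s \<noteq> \<zero>\<^bsub>K\<^esub>} = insert t T"
      let ?q = "p(t := \<zero>\<^bsub>K\<^esub>)"
      have t: "t \<in> S" "p t \<in> carrier K" using a by (auto simp: free_space_simps)
      have sup: "{s \<in> S. ?q s \<noteq> \<zero>\<^bsub>K\<^esub>} = T" using a insert by auto
      have q: "?q \<in> carrier ?F" using a insert t sup
        by (auto simp: free_space_simps PiE_iff extensional_def)
      have "P ?q" using insert q sup by blast
      then have "P (p t \<odot>\<^bsub>?F\<^esub> free_gen K S t \<oplus>\<^bsub>?F\<^esub> ?q)" using step t q by blast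
      also have "p t \<odot>\<^bsub>?F\<^esub> free_gen K S t \<oplus>\<^bsub>?F\<^esub> ?q = p"
        using a t by (auto simp: free_space_ops[OF K.ring_axioms] free_gen_def free_space_simps PiE_iff extensional_def fun_eq_iff restrict_def)
      finally show "P p" .
    qed
  qed
  then show ?thesis using p by (auto simp: free_space_simps)
qed

lemma free_lift:
  assumes U: "module K U" and f: "\<And>s. s \<in> S \<Longrightarrow> f s \<in> carrier U"
  shows "\<exists>h \<in> module_hom K (free_space K S) U. \<forall>s\<in>S. h (free_gen K S s) = f s"
proof -
  interpret U: module K U by fact
  let ?F = "free_space K S"
  note K = U.R.ring_axioms
  define h where "h = (\<lambda>p. \<Oplus>\<^bsub>U\<^esub>s\<in>{s\<in>S. p s \<noteq> \<zero>\<^bsub>K\<^esub>}. p s \<odot>\<^bsub>U\<^esub> f s)"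
  have ext: "h p = (\<Oplus>\<^bsub>U\<^esub>s\<in>T. p s \<odot>\<^bsub>U\<^esub> f s)"
    if "finite T" "T \<subseteq> S" "{s\<in>S. p s \<noteq> \<zero>\<^bsub>K\<^esub>} \<subseteq> T" "p \<in> S \<rightarrow> carrier K" for p T
    unfolding h_def
    by (rule U.M.add.finprod_mono_neutral_cong_left) (use that f in \<open>auto simp: Pi_iff\<close>)
  have "h \<in> module_hom K ?F U"
  proof (unfold module_hom_def, safe)
    fix p assume "p \<in> carrier ?F" then show "h p \<in> carrier U"
      unfolding h_def by (auto intro!: U.M.finsum_closed U.smult_closed f simp: free_space_simps)
  next
    fix p q assume pq: "p \<in> carrier ?F" "q \<in> carrier ?F"
    let ?T = "{s\<in>S. p s \<noteq> \<zero>\<^bsub>K\<^esub>} \<union> {s\<in>S. q s \<noteq> \<zero>\<^bsub>K\<^esub>}"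
    have T: "finite ?T" "?T \<subseteq> S" using pq by (auto simp: free_space_simps)
    have c: "p \<in> S \<rightarrow> carrier K" "q \<in> S \<rightarrow> carrier K" using pq by (auto simp: free_space_simps)
    have s: "p \<oplus>\<^bsub>?F\<^esub> q \<in> S \<rightarrow> carrier K" using c by (auto simp: free_space_ops[OF K])
    have "h (p \<oplus>\<^bsub>?F\<^esub> q) = (\<Oplus>\<^bsub>U\<^esub>s\<in>?T. (p \<oplus>\<^bsub>?F\<^esub> q) s \<odot>\<^bsub>U\<^esub> f s)"
      by (rule ext[OF T _ s]) (auto simp: free_space_ops[OF K])
    also have "\<dots> = (\<Oplus>\<^bsub>U\<^esub>s\<in>?T. p s \<odot>\<^bsub>U\<^esub> f s \<oplus>\<^bsub>U\<^esub> q s \<odot>\<^bsub>U\<^esub> f s)"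
      using c f by (intro U.M.finsum_cong') (auto simp: free_space_ops[OF K] U.smult_l_distr Pi_iff)
    also have "\<dots> = h p \<oplus>\<^bsub>U\<^esub> h q"
      using c f T
      by (subst ext[OF T _ c(1)], force, subst ext[OF T _ c(2)], force, intro U.M.finsum_addf)
        (auto simp: Pi_iff)
    finally show "h (p \<oplus>\<^bsub>?F\<^esub> q) = h p \<oplus>\<^bsub>U\<^esub> h q" .
  next
    fix r p assume r: "r \<in> carrier K" and p: "p \<in> carrier ?F"
    let ?T = "{s\<in>S. p s \<noteq> \<zero>\<^bsub>K\<^esub>}"
    have T: "finite ?T" "?T \<subseteq> S" using p by (auto simp: free_space_simps)
    have c: "p \<in> S \<rightarrow> carrier K" using p by (auto simp: free_space_simps)
    have s: "r \<odot>\<^bsub>?F\<^esub> p \<in> S \<rightarrow> carrier K" using c r by (auto simp: free_space_ops[OF K])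
    have "h (r \<odot>\<^bsub>?F\<^esub> p) = (\<Oplus>\<^bsub>U\<^esub>s\<in>?T. (r \<odot>\<^bsub>?F\<^esub> p) s \<odot>\<^bsub>U\<^esub> f s)"
      by (rule ext[OF T _ s]) (use r in \<open>auto simp: free_space_ops[OF K]\<close>)
    also have "\<dots> = (\<Oplus>\<^bsub>U\<^esub>s\<in>?T. r \<odot>\<^bsub>U\<^esub> (p s \<odot>\<^bsub>U\<^esub> f s))"
      using c f r by (intro U.M.finsum_cong') (auto simp: free_space_ops[OF K] U.smult_assoc1 Pi_iff)
    also have "\<dots> = r \<odot>\<^bsub>U\<^esub> h p"
      unfolding h_def using c f r T by (subst U.finsum_smult) (auto simp: Pi_iff)
    finally show "h (r \<odot>\<^bsub>?F\<^esub> p) = r \<odot>\<^bsub>U\<^esub> h p" .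
  qed
  moreover have "h (free_gen K S s) = f s" if s: "s \<in> S" for s
  proof -
    have "h (free_gen K S s) = (\<Oplus>\<^bsub>U\<^esub>t\<in>{s}. free_gen K S s t \<odot>\<^bsub>U\<^esub> f t)"
      by (rule ext) (use s in \<open>auto simp: free_gen_def\<close>)
    also have "\<dots> = f s" using s f by (simp add: free_gen_def)
    finally show ?thesis .
  qed
  ultimately show ?thesis by blast
qed

lemma tensor_rels_subset:
  assumes "module K V" "module K W"
  shows "tensor_rels K V W \<subseteq> carrier (free_space K (carrier V \<times> carrier W))"
proof -
  interpret V: module K V by fact
  interpret W: module K W by fact
  interpret F: module K "free_space K (carrier V \<times> carrier W)"
    by (rule module_free_space) (rule V.R.cring_axioms)
  have g: "free_gen K (carrier V \<times> carrier W) (v, w) \<in> carrier (free_space K (carrier V \<times> carrier W))"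
    if "v \<in> carrier V" "w \<in> carrier W" for v w
    by (rule free_gen_closed[OF V.R.cring_axioms]) (use that in simp)
  show ?thesis
    unfolding tensor_rels_def Let_def
    by (intro Un_least subsetI; elim CollectE exE conjE; hypsubst;
        intro F.M.minus_closed F.M.a_closed F.smult_closed g V.M.a_closed W.M.a_closed
          V.smult_closed W.smult_closed; assumption)
qed

lemma tensor_relsI:
  fixes K V W
  defines "F \<equiv> free_space K (carrier V \<times> carrier W)"
    and "g \<equiv> \<lambda>v w. free_gen K (carrier V \<times> carrier W) (v, w)"
  assumes "v \<in> carrier V" "w \<in> carrier W"
  shows "v' \<in> carrier V \<Longrightarrow> g (v \<oplus>\<^bsub>V\<^esub> v') w \<ominus>\<^bsub>F\<^esub> (g v w \<oplus>\<^bsub>F\<^esub> g v' w) \<in> tensor_rels K V W"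
    and "w' \<in> carrier W \<Longrightarrow> g v (w \<oplus>\<^bsub>W\<^esub> w') \<ominus>\<^bsub>F\<^esub> (g v w \<oplus>\<^bsub>F\<^esub> g v w') \<in> tensor_rels K V W"
    and "c \<in> carrier K \<Longrightarrow> g (c \<odot>\<^bsub>V\<^esub> v) w \<ominus>\<^bsub>F\<^esub> (c \<odot>\<^bsub>F\<^esub> g v w) \<in> tensor_rels K V W"
    and "c \<in> carrier K \<Longrightarrow> g v (c \<odot>\<^bsub>W\<^esub> w) \<ominus>\<^bsub>F\<^esub> (c \<odot>\<^bsub>F\<^esub> g v w) \<in> tensor_rels K V W"
  using assms(3,4) unfolding tensor_rels_def Let_def F_def g_def by blast+

lemma submodule_rels:
  assumes "module K V" "module K W"
  shows "submodule K (lin_span K (free_space K (carrier V \<times> carrier W)) (tensor_rels K V W))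
    (free_space K (carrier V \<times> carrier W))"
proof -
  interpret V: module K V by fact
  interpret F: module K "free_space K (carrier V \<times> carrier W)"
    by (rule module_free_space) (rule V.R.cring_axioms)
  show ?thesis by (rule F.span_is_submodule[OF tensor_rels_subset[OF assms]])
qed

lemma module_tensor_space:
  assumes "module K V" "module K W"
  shows "module K (tensor_space K V W)"
proof -
  interpret V: module K V by fact
  show ?thesis unfolding tensor_space_def Let_def
    by (intro module_quotient_space module_free_space submodule_rels assms V.R.cring_axioms)
qed

lemma tensor_bilinear_map:
  assumes V: "module K V" and W: "module K W"
  shows "bilinear_map K V W (tensor_space K V W) (tensor K V W)"
proof -
  interpret V: module K V by fact
  interpret W: module K W by fact
  let ?S = "carrier V \<times> carrier W"
  let ?F = "free_space K ?S" let ?N = "lin_span K ?F (tensor_rels K V W)"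
  let ?T = "tensor_space K V W"
  interpret F: module K ?F by (rule module_free_space) (rule V.R.cring_axioms)
  interpret N: submodule K ?N ?F by (rule submodule_rels[OF assms])
  interpret T: module K ?T by (rule module_tensor_space[OF assms])
  have pr: "(\<lambda>x. ?N +>\<^bsub>?F\<^esub> x) \<in> module_hom K ?F ?T"
    unfolding tensor_space_def Let_def
    by (rule module_quotient_space) (rule F.module_axioms N.submodule_axioms)+
  interpret pr: mod_hom K ?F ?T "\<lambda>x. ?N +>\<^bsub>?F\<^esub> x" by unfold_locales (rule pr)
  note g = free_gen_closed[OF V.R.cring_axioms]
  have t: "tensor K V W v w = ?N +>\<^bsub>?F\<^esub> free_gen K ?S (v, w)" for v w
    by (simp add: tensor_def Let_def)
  have z: "?N +>\<^bsub>?F\<^esub> x = \<zero>\<^bsub>?T\<^esub>" if "x \<in> tensor_rels K V W" for x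
  proof -
    have "x \<in> ?N" using that F.in_own_span[OF tensor_rels_subset[OF assms]] by auto
    have "subgroup ?N (add_monoid ?F)"
      by (rule submodule_subgroup[OF F.module_axioms N.submodule_axioms])
    then have "?N +>\<^bsub>?F\<^esub> x = ?N" using \<open>x \<in> ?N\<close> N.subset by (intro F.M.a_coset_join2) auto
    then show ?thesis by (simp add: tensor_space_def quotient_space_def Let_def)
  qed
  have eq: "?N +>\<^bsub>?F\<^esub> x = ?N +>\<^bsub>?F\<^esub> y" if "x \<ominus>\<^bsub>?F\<^esub> y \<in> tensor_rels K V W" "x \<in> carrier ?F" "y \<in> carrier ?F" for x y
  proof -
    have "x = (x \<ominus>\<^bsub>?F\<^esub> y) \<oplus>\<^bsub>?F\<^esub> y" using that by (simp add: F.M.minus_eq F.M.a_assoc F.M.l_neg)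
    then have "?N +>\<^bsub>?F\<^esub> x = (?N +>\<^bsub>?F\<^esub> (x \<ominus>\<^bsub>?F\<^esub> y)) \<oplus>\<^bsub>?T\<^esub> (?N +>\<^bsub>?F\<^esub> y)"
      using that pr.f_add[of "x \<ominus>\<^bsub>?F\<^esub> y" y] by simp
    also have "\<dots> = ?N +>\<^bsub>?F\<^esub> y" using z that(1,3) pr.f_im by (simp add: pr T.M.l_zero)
    finally show ?thesis .
  qed
  have eq_add: "?N +>\<^bsub>?F\<^esub> x = (?N +>\<^bsub>?F\<^esub> y) \<oplus>\<^bsub>?T\<^esub> (?N +>\<^bsub>?F\<^esub> z)"
    if "x \<ominus>\<^bsub>?F\<^esub> (y \<oplus>\<^bsub>?F\<^esub> z) \<in> tensor_rels K V W" "x \<in> carrier ?F" "y \<in> carrier ?F" "z \<in> carrier ?F"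
    for x y z using eq[OF that(1)] that pr.f_add[OF that(3,4)] by simp
  have eq_smult: "?N +>\<^bsub>?F\<^esub> x = c \<odot>\<^bsub>?T\<^esub> (?N +>\<^bsub>?F\<^esub> y)"
    if "x \<ominus>\<^bsub>?F\<^esub> (c \<odot>\<^bsub>?F\<^esub> y) \<in> tensor_rels K V W" "x \<in> carrier ?F" "y \<in> carrier ?F" "c \<in> carrier K"
    for x y c using eq[OF that(1)] that pr.f_smult[OF that(4,3)] by simp
  show ?thesis
    unfolding bilinear_map_def t
  proof (intro conjI ballI)
    fix v w assume "v \<in> carrier V" "w \<in> carrier W"
    then show "?N +>\<^bsub>?F\<^esub> free_gen K ?S (v, w) \<in> carrier ?T" using pr g[of "(v, w)" ?S]
      by (auto simp: module_hom_def Pi_iff)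
  next
    fix v v' w assume a: "v \<in> carrier V" "v' \<in> carrier V" "w \<in> carrier W"
    show "?N +>\<^bsub>?F\<^esub> free_gen K ?S (v \<oplus>\<^bsub>V\<^esub> v', w) = (?N +>\<^bsub>?F\<^esub> free_gen K ?S (v, w)) \<oplus>\<^bsub>?T\<^esub> (?N +>\<^bsub>?F\<^esub> free_gen K ?S (v', w))"
      by (intro eq_add tensor_relsI(1) a g SigmaI V.M.a_closed)
  next
    fix v w w' assume a: "v \<in> carrier V" "w' \<in> carrier W" "w \<in> carrier W"
    show "?N +>\<^bsub>?F\<^esub> free_gen K ?S (v, w \<oplus>\<^bsub>W\<^esub> w') = (?N +>\<^bsub>?F\<^esub> free_gen K ?S (v, w)) \<oplus>\<^bsub>?T\<^esub> (?N +>\<^bsub>?F\<^esub> free_gen K ?S (v, w'))"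
      by (intro eq_add tensor_relsI(2) a g SigmaI W.M.a_closed)
  next
    fix c v w assume a: "v \<in> carrier V" "w \<in> carrier W" "c \<in> carrier K"
    show "?N +>\<^bsub>?F\<^esub> free_gen K ?S (c \<odot>\<^bsub>V\<^esub> v, w) = c \<odot>\<^bsub>?T\<^esub> (?N +>\<^bsub>?F\<^esub> free_gen K ?S (v, w))"
      by (intro eq_smult tensor_relsI(3) a g SigmaI V.smult_closed)
    show "?N +>\<^bsub>?F\<^esub> free_gen K ?S (v, c \<odot>\<^bsub>W\<^esub> w) = c \<odot>\<^bsub>?T\<^esub> (?N +>\<^bsub>?F\<^esub> free_gen K ?S (v, w))"
      by (intro eq_smult tensor_relsI(4) a g SigmaI W.smult_closed)
  qed
qed


lemma tensor_universal:
  assumes V: "module K V" and W: "module K W" and U: "module K U" and f: "bilinear_map K V W U f"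
  shows "\<exists>!h. h \<in> module_hom K (tensor_space K V W) U
       \<and> h \<in> extensional (carrier (tensor_space K V W))
       \<and> (\<forall>v\<in>carrier V. \<forall>w\<in>carrier W. h (tensor K V W v w) = f v w)"
proof -
  interpret V: module K V by fact
  interpret W: module K W by fact
  interpret U: module K U by fact
  let ?S = "carrier V \<times> carrier W"
  let ?F = "free_space K ?S" let ?N = "lin_span K ?F (tensor_rels K V W)"
  let ?T = "tensor_space K V W"
  interpret F: module K ?F by (rule module_free_space) (rule V.R.cring_axioms)
  interpret N: submodule K ?N ?F by (rule submodule_rels[OF V W])
  interpret T: module K ?T by (rule module_tensor_space[OF V W])
  have pr: "(\<lambda>x. ?N +>\<^bsub>?F\<^esub> x) \<in> module_hom K ?F ?T"
    and car: "carrier ?T = (\<lambda>x. ?N +>\<^bsub>?F\<^esub> x) ` carrier ?F"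
    unfolding tensor_space_def Let_def
    by (rule module_quotient_space, rule F.module_axioms, rule N.submodule_axioms)+
  interpret pr: mod_hom K ?F ?T "\<lambda>x. ?N +>\<^bsub>?F\<^esub> x" by unfold_locales (rule pr)
  note g = free_gen_closed[OF V.R.cring_axioms]
  have t: "tensor K V W v w = ?N +>\<^bsub>?F\<^esub> free_gen K ?S (v, w)" for v w
    by (simp add: tensor_def Let_def)
  have fc: "(case s of (v, w) \<Rightarrow> f v w) \<in> carrier U" if "s \<in> ?S" for s
    using that f by (auto simp: bilinear_map_def)
  from free_lift[OF U, of ?S "\<lambda>s. case s of (v, w) \<Rightarrow> f v w", OF fc]
  obtain h0 where h0_hom: "h0 \<in> module_hom K ?F U"
    and h0_gen: "\<forall>s\<in>?S. h0 (free_gen K ?S s) = (case s of (v, w) \<Rightarrow> f v w)" by blast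
  have "h0 (free_gen K ?S (v, w)) = f v w" if "v \<in> carrier V" "w \<in> carrier W" for v w
    using that by (simp add: h0_gen)
  note h0 = h0_hom this
  interpret h0: mod_hom K ?F U h0 by unfold_locales (rule h0)
  have minus: "h0 (x \<ominus>\<^bsub>?F\<^esub> y) = \<zero>\<^bsub>U\<^esub>" if "x \<in> carrier ?F" "y \<in> carrier ?F" "h0 x = h0 y" for x y
  proof -
    have "h0 x = h0 ((x \<ominus>\<^bsub>?F\<^esub> y) \<oplus>\<^bsub>?F\<^esub> y)" using that by (simp add: F.M.minus_eq F.M.a_assoc F.M.l_neg)
    also have "\<dots> = h0 (x \<ominus>\<^bsub>?F\<^esub> y) \<oplus>\<^bsub>U\<^esub> h0 y" using that by simp
    finally have "h0 y = h0 (x \<ominus>\<^bsub>?F\<^esub> y) \<oplus>\<^bsub>U\<^esub> h0 y" using that by simp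
    moreover have "h0 y \<in> carrier U" "h0 (x \<ominus>\<^bsub>?F\<^esub> y) \<in> carrier U"
      using h0(1) that F.M.minus_closed[OF that(1,2)] by (auto simp: module_hom_def)
    ultimately show ?thesis by (metis U.M.add.r_cancel_one')
  qed
  have gg: "free_gen K ?S (v, w) \<in> carrier ?F" if "v \<in> carrier V" "w \<in> carrier W" for v w
    using that by (intro g) simp
  have bil: "\<And>v v' w. v \<in> carrier V \<Longrightarrow> v' \<in> carrier V \<Longrightarrow> w \<in> carrier W
      \<Longrightarrow> f (v \<oplus>\<^bsub>V\<^esub> v') w = f v w \<oplus>\<^bsub>U\<^esub> f v' w"
    "\<And>v w w'. v \<in> carrier V \<Longrightarrow> w \<in> carrier W \<Longrightarrow> w' \<in> carrier W
      \<Longrightarrow> f v (w \<oplus>\<^bsub>W\<^esub> w') = f v w \<oplus>\<^bsub>U\<^esub> f v w'"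
    "\<And>c v w. c \<in> carrier K \<Longrightarrow> v \<in> carrier V \<Longrightarrow> w \<in> carrier W
      \<Longrightarrow> f (c \<odot>\<^bsub>V\<^esub> v) w = c \<odot>\<^bsub>U\<^esub> f v w"
    "\<And>c v w. c \<in> carrier K \<Longrightarrow> v \<in> carrier V \<Longrightarrow> w \<in> carrier W
      \<Longrightarrow> f v (c \<odot>\<^bsub>W\<^esub> w) = c \<odot>\<^bsub>U\<^esub> f v w"
    using f unfolding bilinear_map_def by blast+
  have "h0 x = \<zero>\<^bsub>U\<^esub>" if "x \<in> tensor_rels K V W" for x
    using that unfolding tensor_rels_def Let_def
    by (elim UnE CollectE exE conjE; hypsubst; intro minus; simp add: gg h0(2) bil)
  then have "tensor_rels K V W \<subseteq> h0.ker"
    using tensor_rels_subset[OF V W] by (auto simp: h0.ker_def)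
  then have ker: "?N \<subseteq> h0.ker"
    by (rule F.span_is_subset[OF _ h0.ker_is_submodule])
  have coset: "h0 x = h0 y" if "x \<in> ?N +>\<^bsub>?F\<^esub> y" "y \<in> carrier ?F" for x y
    using that ker N.subset h0(1) by (auto simp: a_r_coset_def' h0.ker_def module_hom_def)
  have self: "x \<in> ?N +>\<^bsub>?F\<^esub> x" if "x \<in> carrier ?F" for x
  proof -
    have "x = \<zero>\<^bsub>?F\<^esub> \<oplus>\<^bsub>?F\<^esub> x" using that by simp
    then show ?thesis using N.zero_closed unfolding a_r_coset_def' by blast
  qed
  define h where "h = (\<lambda>X\<in>carrier ?T. h0 (SOME x. x \<in> X))"
  have h: "h (?N +>\<^bsub>?F\<^esub> x) = h0 x" if "x \<in> carrier ?F" for x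
  proof -
    have "(SOME y. y \<in> ?N +>\<^bsub>?F\<^esub> x) \<in> ?N +>\<^bsub>?F\<^esub> x" 
      by (rule someI[of "\<lambda>y. y \<in> ?N +>\<^bsub>?F\<^esub> x", OF self[OF that]])
    from coset[OF this that] have "h0 (SOME y. y \<in> ?N +>\<^bsub>?F\<^esub> x) = h0 x" .
    moreover have "?N +>\<^bsub>?F\<^esub> x \<in> carrier ?T" unfolding car using that by (rule imageI)
    ultimately show ?thesis by (simp add: h_def)
  qed
  have "h \<in> module_hom K ?T U"
    unfolding module_hom_def
  proof (intro CollectI conjI allI impI; (elim conjE)?)
    show "h \<in> carrier ?T \<rightarrow> carrier U"
    proof
      fix X assume "X \<in> carrier ?T"
      then obtain x where "x \<in> carrier ?F" "X = ?N +>\<^bsub>?F\<^esub> x" unfolding car by blast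
      then show "h X \<in> carrier U" using h[of x] h0(1) by (auto simp: module_hom_def)
    qed
  next
    fix X Y assume "X \<in> carrier ?T" "Y \<in> carrier ?T"
    then obtain x y where "x \<in> carrier ?F" "X = ?N +>\<^bsub>?F\<^esub> x" "y \<in> carrier ?F" "Y = ?N +>\<^bsub>?F\<^esub> y"
      unfolding car by blast
    then show "h (X \<oplus>\<^bsub>?T\<^esub> Y) = h X \<oplus>\<^bsub>U\<^esub> h Y"
      using h[of x] h[of y] h[of "x \<oplus>\<^bsub>?F\<^esub> y"] pr.f_add[of x y] h0.f_add[of x y] by simp
  next
    fix r X assume "r \<in> carrier K" "X \<in> carrier ?T"
    then obtain x where "x \<in> carrier ?F" "X = ?N +>\<^bsub>?F\<^esub> x" unfolding car by blast
    then show "h (r \<odot>\<^bsub>?T\<^esub> X) = r \<odot>\<^bsub>U\<^esub> h X"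
      using \<open>r \<in> carrier K\<close> h[of x] h[of "r \<odot>\<^bsub>?F\<^esub> x"] pr.f_smult[of r x] h0.f_smult[of r x] by simp
  qed
  moreover have "h \<in> extensional (carrier ?T)" by (simp add: h_def)
  moreover have "h (tensor K V W v w) = f v w" if "v \<in> carrier V" "w \<in> carrier W" for v w
    using that by (simp add: t h h0(2) g)
  moreover have "h1 = h2"
    if h1: "h1 \<in> module_hom K ?T U" "h1 \<in> extensional (carrier ?T)" "\<And>v w. v \<in> carrier V \<Longrightarrow> w \<in> carrier W \<Longrightarrow> h1 (tensor K V W v w) = f v w"
    and h2: "h2 \<in> module_hom K ?T U" "h2 \<in> extensional (carrier ?T)" "\<And>v w. v \<in> carrier V \<Longrightarrow> w \<in> carrier W \<Longrightarrow> h2 (tensor K V W v w) = f v w"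
  for h1 h2
  proof (rule extensionalityI[OF h1(2) h2(2)])
    fix X assume "X \<in> carrier ?T"
    then obtain p where p: "p \<in> carrier ?F" "X = ?N +>\<^bsub>?F\<^esub> p" unfolding car by blast
    interpret h1: mod_hom K ?T U h1 by unfold_locales (rule h1)
    interpret h2: mod_hom K ?T U h2 by unfold_locales (rule h2)
    have prc: "?N +>\<^bsub>?F\<^esub> x \<in> carrier ?T" if "x \<in> carrier ?F" for x
      unfolding car using that by (rule imageI)
    have "h1 (?N +>\<^bsub>?F\<^esub> p) = h2 (?N +>\<^bsub>?F\<^esub> p)"
    proof (rule free_induct[OF V.R.cring_axioms p(1)])
      have "?N +>\<^bsub>?F\<^esub> \<zero>\<^bsub>?F\<^esub> = \<zero>\<^bsub>?T\<^esub>" by (rule pr.f0_is_0)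
      then show "h1 (?N +>\<^bsub>?F\<^esub> \<zero>\<^bsub>?F\<^esub>) = h2 (?N +>\<^bsub>?F\<^esub> \<zero>\<^bsub>?F\<^esub>)"
        using h1.f0_is_0 h2.f0_is_0 by simp
    next
      fix c s q assume a: "c \<in> carrier K" "s \<in> ?S" "q \<in> carrier ?F"
        "h1 (?N +>\<^bsub>?F\<^esub> q) = h2 (?N +>\<^bsub>?F\<^esub> q)"
      obtain v w where s: "s = (v, w)" "v \<in> carrier V" "w \<in> carrier W" using a(2) by auto
      have "h1 (?N +>\<^bsub>?F\<^esub> free_gen K ?S s) = h2 (?N +>\<^bsub>?F\<^esub> free_gen K ?S s)"
        using h1(3)[OF s(2,3)] h2(3)[OF s(2,3)] s(1) by (simp add: t)
      then show "h1 (?N +>\<^bsub>?F\<^esub> (c \<odot>\<^bsub>?F\<^esub> free_gen K ?S s \<oplus>\<^bsub>?F\<^esub> q)) = h2 (?N +>\<^bsub>?F\<^esub> (c \<odot>\<^bsub>?F\<^esub> free_gen K ?S s \<oplus>\<^bsub>?F\<^esub> q))"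
        using a g[OF a(2)] by (simp add: prc)
    qed
    then show "h1 X = h2 X" using p by simp
  qed
  ultimately show ?thesis by (intro ex1I[of _ h]) blast+
qed

lemma
  assumes "module K V" "module K W" "module K U" "bilinear_map K V W U f"
  shows tensor_lift_linear: "tensor_lift K V W U f \<in> module_hom K (tensor_space K V W) U"
    and tensor_lift_tensor: "\<And>v w. v \<in> carrier V \<Longrightarrow> w \<in> carrier W
      \<Longrightarrow> tensor_lift K V W U f (tensor K V W v w) = f v w"
  using theI'[OF tensor_universal[OF assms]] unfolding tensor_lift_def by blast+


subsection \<open>Maps between tensor products\<close>

definition tensor_map where
  "tensor_map K V W V' W' f g =
    tensor_lift K V W (tensor_space K V' W') (\<lambda>v w. tensor K V' W' (f v) (g w))"

definition tensor_flip where
  "tensor_flip K V W = tensor_lift K V W (tensor_space K W V) (\<lambda>v w. tensor K W V w v)"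

text \<open>\<open>\<phi> \<otimes> W\<close> and \<open>V \<otimes> \<psi>\<close> for functionals \<open>\<phi>\<close>, \<open>\<psi>\<close>, with \<open>k \<otimes> W = W\<close> and \<open>V \<otimes> k = V\<close>
  suppressed, and \<open>\<phi> \<otimes> \<psi>\<close>, with \<open>k \<otimes> k = k\<close> suppressed.\<close>

definition slice_left where
  "slice_left K V W \<phi> = tensor_lift K V W W (\<lambda>v w. \<phi> v \<odot>\<^bsub>W\<^esub> w)"

definition slice_right where
  "slice_right K V W \<psi> = tensor_lift K V W V (\<lambda>v w. \<psi> w \<odot>\<^bsub>V\<^esub> v)"

definition tensor_functional where
  "tensor_functional K V W \<phi> \<psi> = tensor_lift K V W (self_module K) (\<lambda>v w. \<phi> v \<otimes>\<^bsub>K\<^esub> \<psi> w)"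

text \<open>
  Threefold tensor products are bracketed to the left: \<open>tensor3_space K U V W\<close> is
  \<open>(U \<otimes> V) \<otimes> W\<close>. A map \<open>U \<otimes> f\<close> is conjugated with the associativity isomorphisms.
\<close>

definition tensor3_space where
  "tensor3_space K U V W = tensor_space K (tensor_space K U V) W"

definition assoc_right where
  "assoc_right K U V W =
    tensor_lift K (tensor_space K U V) W (tensor_space K U (tensor_space K V W))
      (\<lambda>x w. tensor_lift K U V (tensor_space K U (tensor_space K V W))
         (\<lambda>u v. tensor K U (tensor_space K V W) u (tensor K V W v w)) x)"

definition assoc_left where
  "assoc_left K U V W =
    tensor_lift K U (tensor_space K V W) (tensor3_space K U V W)
      (\<lambda>u y. tensor_lift K V W (tensor3_space K U V W)
         (\<lambda>v w. tensor K (tensor_space K U V) W (tensor K U V u v) w) y)"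

text \<open>\<open>leg12 K V W V' W' Z f\<close> is \<open>f \<otimes> Z\<close>, \<open>leg23 K Z V W V' W' f\<close> is \<open>Z \<otimes> f\<close> and
  \<open>leg13 K V Z W V' W' f\<close> is \<open>f\<^sup>1\<^sup>3 : V \<otimes> Z \<otimes> W \<rightarrow> V' \<otimes> Z \<otimes> W'\<close>, for \<open>f : V \<otimes> W \<rightarrow> V' \<otimes> W'\<close>.\<close>

definition leg12 where
  "leg12 K V W V' W' Z f =
    tensor_map K (tensor_space K V W) Z (tensor_space K V' W') Z f (\<lambda>z. z)"

definition leg23 where
  "leg23 K Z V W V' W' f =
    assoc_left K Z V' W'
    \<circ> tensor_map K Z (tensor_space K V W) Z (tensor_space K V' W') (\<lambda>z. z) f
    \<circ> assoc_right K Z V W"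

definition leg13 where
  "leg13 K V Z W V' W' f =
    leg23 K V' W' Z Z W' (tensor_flip K W' Z) \<circ> leg12 K V W V' W' Z f \<circ> leg23 K V Z W W Z (tensor_flip K Z W)"


section \<open>Regular weak multiplier bialgebras\<close>

locale nonunital_algebra = vectorspace K A for K and A +
  assumes mult_closed:
      "\<lbrakk>a \<in> carrier A; b \<in> carrier A\<rbrakk> \<Longrightarrow> a \<otimes>\<^bsub>A\<^esub> b \<in> carrier A"
    and mult_assoc:
      "\<lbrakk>a \<in> carrier A; b \<in> carrier A; c \<in> carrier A\<rbrakk>
        \<Longrightarrow> (a \<otimes>\<^bsub>A\<^esub> b) \<otimes>\<^bsub>A\<^esub> c = a \<otimes>\<^bsub>A\<^esub> (b \<otimes>\<^bsub>A\<^esub> c)"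
    and mult_add_left:
      "\<lbrakk>a \<in> carrier A; b \<in> carrier A; c \<in> carrier A\<rbrakk>
        \<Longrightarrow> (a \<oplus>\<^bsub>A\<^esub> b) \<otimes>\<^bsub>A\<^esub> c = (a \<otimes>\<^bsub>A\<^esub> c) \<oplus>\<^bsub>A\<^esub> (b \<otimes>\<^bsub>A\<^esub> c)"
    and mult_add_right:
      "\<lbrakk>a \<in> carrier A; b \<in> carrier A; c \<in> carrier A\<rbrakk>
        \<Longrightarrow> a \<otimes>\<^bsub>A\<^esub> (b \<oplus>\<^bsub>A\<^esub> c) = (a \<otimes>\<^bsub>A\<^esub> b) \<oplus>\<^bsub>A\<^esub> (a \<otimes>\<^bsub>A\<^esub> c)"
    and mult_smult_left:
      "\<lbrakk>r \<in> carrier K; a \<in> carrier A; b \<in> carrier A\<rbrakk>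
        \<Longrightarrow> (r \<odot>\<^bsub>A\<^esub> a) \<otimes>\<^bsub>A\<^esub> b = r \<odot>\<^bsub>A\<^esub> (a \<otimes>\<^bsub>A\<^esub> b)"
    and mult_smult_right:
      "\<lbrakk>r \<in> carrier K; a \<in> carrier A; b \<in> carrier A\<rbrakk>
        \<Longrightarrow> a \<otimes>\<^bsub>A\<^esub> (r \<odot>\<^bsub>A\<^esub> b) = r \<odot>\<^bsub>A\<^esub> (a \<otimes>\<^bsub>A\<^esub> b)"
begin

abbreviation (input) AA where "AA \<equiv> tensor_space K A A"
abbreviation (input) AAA where "AAA \<equiv> tensor3_space K A A A"
abbreviation (input) tensor_AA (infixl \<open>\<boxtimes>\<close> 75) where "a \<boxtimes> b \<equiv> tensor K A A a b"

text \<open>An element \<open>a \<otimes> b\<close> acts on \<open>A \<otimes> A\<close> by \<open>on_AA (lmul a) (lmul b)\<close> from the left and by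
  \<open>on_AA (rmul a) (rmul b)\<close> from the right; \<open>idm\<close> stands in for a formal unit \<open>1\<close>.\<close>

abbreviation (input) lmul where "lmul a \<equiv> (\<lambda>x. a \<otimes>\<^bsub>A\<^esub> x)"
abbreviation (input) rmul where "rmul a \<equiv> (\<lambda>x. x \<otimes>\<^bsub>A\<^esub> a)"
abbreviation (input) idm where "idm \<equiv> (\<lambda>x. x)"
abbreviation (input) on_AA where "on_AA f g \<equiv> tensor_map K A A A A f g"

definition mu where "mu = tensor_lift K A A A (mult A)"

abbreviation (input) "A12" where "A12 f \<equiv> leg12 K A A A A A f"
abbreviation (input) "A13" where "A13 f \<equiv> leg13 K A A A A A f"
abbreviation (input) "A23" where "A23 f \<equiv> leg23 K A A A A A f"
abbreviation (input) mu_A where "mu_A \<equiv> tensor_map K AA A A A mu idm"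

end

locale regular_weak_multiplier_bialgebra = nonunital_algebra K A for K and A +
  fixes E1 E2 T1 T2 T3 T4 and \<epsilon>
  assumes idempotent: "mu ` carrier AA = carrier A"
    and nondegenerate_left:
      "\<lbrakk>a \<in> carrier A; \<forall>b\<in>carrier A. a \<otimes>\<^bsub>A\<^esub> b = \<zero>\<^bsub>A\<^esub>\<rbrakk> \<Longrightarrow> a = \<zero>\<^bsub>A\<^esub>"
    and nondegenerate_right:
      "\<lbrakk>a \<in> carrier A; \<forall>b\<in>carrier A. b \<otimes>\<^bsub>A\<^esub> a = \<zero>\<^bsub>A\<^esub>\<rbrakk> \<Longrightarrow> a = \<zero>\<^bsub>A\<^esub>"
    and E1_linear: "E1 \<in> module_hom K AA AA"
    and E2_linear: "E2 \<in> module_hom K AA AA"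
    and T1_linear: "T1 \<in> module_hom K AA AA"
    and T2_linear: "T2 \<in> module_hom K AA AA"
    and T3_linear: "T3 \<in> module_hom K AA AA"
    and T4_linear: "T4 \<in> module_hom K AA AA"
    and counit_linear: "\<epsilon> \<in> module_hom K A (self_module K)"
    and E1_E2: "\<lbrakk>a \<in> carrier A; b \<in> carrier A; c \<in> carrier A; d \<in> carrier A\<rbrakk>
      \<Longrightarrow> on_AA (lmul a) (lmul b) (E1 (c \<boxtimes> d)) = on_AA (rmul c) (rmul d) (E2 (a \<boxtimes> b))"
    and E1_idem: "x \<in> carrier AA \<Longrightarrow> E1 (E1 x) = E1 x"
    and T2_T1: "y \<in> carrier AAA \<Longrightarrow> A12 T2 (A23 T1 y) = A23 T1 (A12 T2 y)"
    and counit_T1: "x \<in> carrier AA \<Longrightarrow> slice_left K A A \<epsilon> (T1 x) = mu x"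
    and counit_T2: "x \<in> carrier AA \<Longrightarrow> slice_right K A A \<epsilon> (T2 x) = mu x"
    and T1_mult: "y \<in> carrier AAA \<Longrightarrow> mu_A (A13 T1 (A23 T1 y)) = T1 (mu_A y)"
    and span_E1:
      "lin_span K AA {on_AA (rmul b) idm (T1 (a \<boxtimes> c)) | a b c.
         a \<in> carrier A \<and> b \<in> carrier A \<and> c \<in> carrier A}
       = lin_span K AA {E1 (b \<boxtimes> c) | b c. b \<in> carrier A \<and> c \<in> carrier A}"
    and span_E2:
      "lin_span K AA {on_AA idm (lmul c) (T2 (b \<boxtimes> a)) | a b c.
         a \<in> carrier A \<and> b \<in> carrier A \<and> c \<in> carrier A}
       = lin_span K AA {E2 (b \<boxtimes> c) | b c. b \<in> carrier A \<and> c \<in> carrier A}"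
    and E1_T1: "y \<in> carrier AAA \<Longrightarrow> A12 E1 (A23 T1 y) = A23 T1 (A12 E1 y)"
    and E2_T2: "y \<in> carrier AAA \<Longrightarrow> A12 E2 (A23 T2 y) = A23 T2 (A13 E2 y)"
    and counit_E1: "\<lbrakk>a \<in> carrier A; b \<in> carrier A; c \<in> carrier A\<rbrakk>
      \<Longrightarrow> slice_left K A A \<epsilon> (on_AA idm (lmul a) (E1 (b \<boxtimes> c)))
        = slice_left K A A \<epsilon> (on_AA (rmul b) idm (T1 (a \<boxtimes> c)))"
    and counit_E2: "\<lbrakk>a \<in> carrier A; b \<in> carrier A; c \<in> carrier A\<rbrakk>
      \<Longrightarrow> slice_left K A A \<epsilon> (on_AA idm (rmul c) (E2 (a \<boxtimes> b)))
        = slice_left K A A \<epsilon> (on_AA idm (lmul b) (T2 (a \<boxtimes> c)))"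
    and T1_T3: "\<lbrakk>a \<in> carrier A; b \<in> carrier A; c \<in> carrier A\<rbrakk>
      \<Longrightarrow> on_AA idm (lmul a) (T1 (c \<boxtimes> b)) = on_AA idm (rmul b) (T3 (c \<boxtimes> a))"
    and T2_T4: "\<lbrakk>a \<in> carrier A; b \<in> carrier A; c \<in> carrier A\<rbrakk>
      \<Longrightarrow> on_AA (rmul b) idm (T2 (a \<boxtimes> c)) = on_AA (lmul a) idm (T4 (b \<boxtimes> c))"


section \<open>Comodules\<close>

locale right_comodule =
  regular_weak_multiplier_bialgebra K A E1 E2 T1 T2 T3 T4 \<epsilon> + V: vectorspace K V
  for K and A and E1 E2 T1 T2 T3 T4 and \<epsilon> and V +
  fixes lam rho
  assumes lam_linear: "lam \<in> module_hom K (tensor_space K V A) (tensor_space K V A)"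
    and rho_linear: "rho \<in> module_hom K (tensor_space K V A) (tensor_space K V A)"
    and lam_rho: "\<lbrakk>v \<in> carrier V; a \<in> carrier A; b \<in> carrier A\<rbrakk>
      \<Longrightarrow> tensor_map K V A V A (\<lambda>w. w) (lmul a) (lam (tensor K V A v b))
        = tensor_map K V A V A (\<lambda>w. w) (rmul b) (rho (tensor K V A v a))"
    and lam_E1: "x \<in> carrier (tensor3_space K V A A)
      \<Longrightarrow> leg12 K V A V A A lam (leg13 K V A A V A lam (leg23 K V A A A A E1 x))
        = leg12 K V A V A A lam (leg13 K V A A V A lam x)"
    and lam_T1: "x \<in> carrier (tensor3_space K V A A)
      \<Longrightarrow> leg12 K V A V A A lam (leg13 K V A A V A lam (leg23 K V A A A A T1 x))
        = leg23 K V A A A A T1 (leg12 K V A V A A lam x)"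

locale left_comodule =
  regular_weak_multiplier_bialgebra K A E1 E2 T1 T2 T3 T4 \<epsilon> + V: vectorspace K V
  for K and A and E1 E2 T1 T2 T3 T4 and \<epsilon> and V +
  fixes lam rho
  assumes lam_linear: "lam \<in> module_hom K (tensor_space K A V) (tensor_space K A V)"
    and rho_linear: "rho \<in> module_hom K (tensor_space K A V) (tensor_space K A V)"
    and lam_rho: "\<lbrakk>v \<in> carrier V; a \<in> carrier A; b \<in> carrier A\<rbrakk>
      \<Longrightarrow> tensor_map K A V A V (lmul a) (\<lambda>w. w) (lam (tensor K A V b v))
        = tensor_map K A V A V (rmul b) (\<lambda>w. w) (rho (tensor K A V a v))"
    and lam_E1: "x \<in> carrier (tensor3_space K A A V)
      \<Longrightarrow> leg23 K A A V A V lam (leg13 K A A V A V lam (leg12 K A A A A V E1 x))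
        = leg23 K A A V A V lam (leg13 K A A V A V lam x)"
    and lam_T1: "x \<in> carrier (tensor3_space K A A V)
      \<Longrightarrow> leg23 K A A V A V lam (leg13 K A A V A V lam (leg12 K A A A A V T1 x))
        = leg12 K A A A A V T1 (leg13 K A A V A V lam x)"


section \<open>The dual coaction\<close>

text \<open>The functional \<open>(\<phi> \<otimes> \<alpha>) f(- \<otimes> b)\<close> on \<open>V\<close>.\<close>

definition dual_coeff where
  "dual_coeff K A V f \<alpha> b \<phi> =
    (\<lambda>v\<in>carrier V. tensor_functional K V A \<phi> \<alpha> (f (tensor K V A v b)))"

definition dual_summand where
  "dual_summand K A V a \<alpha> f b \<phi> i =
    tensor K A (dual_space K V) (a i) (dual_coeff K A V f (\<alpha> i) b \<phi>)"

definition dual_support where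
  "dual_support K A V I a \<alpha> f b \<phi> =
    {i \<in> I. dual_summand K A V a \<alpha> f b \<phi> i \<noteq> \<zero>\<^bsub>tensor_space K A (dual_space K V)\<^esub>}"

text \<open>The sum over \<open>I\<close> has to be restricted to the nonzero summands, since \<open>finsum\<close> is degenerate on
  infinite sets.\<close>

definition dual_value where
  "dual_value K A V I a \<alpha> f b \<phi> =
    (\<Oplus>\<^bsub>tensor_space K A (dual_space K V)\<^esub> i \<in> dual_support K A V I a \<alpha> f b \<phi>.
       dual_summand K A V a \<alpha> f b \<phi> i)"

definition dual_coaction where
  "dual_coaction K A V I a \<alpha> f =
    tensor_lift K A (dual_space K V) (tensor_space K A (dual_space K V))
      (dual_value K A V I a \<alpha> f)"

end

theory Submission
  imports Defs
begin

text \<open>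
  Write \<open>V\<^sup>*\<close> for the dual space and \<open>ev\<^sub>v\<close> for the evaluation of functionals at \<open>v \<in> V\<close>. Since \<open>V\<close>
  is finite dimensional, an element of \<open>W \<otimes> V\<^sup>*\<close> is determined by its slices \<open>W \<otimes> ev\<^sub>v\<close>, whatever
  the space \<open>W\<close> (\<open>slices_separate_points\<close>). The map \<open>f\<^sup>* : A \<otimes> V\<^sup>* \<rightarrow> A \<otimes> V\<^sup>*\<close> attached to
  \<open>f : V \<otimes> A \<rightarrow> V \<otimes> A\<close> is then characterised, without reference to a basis, by
  \<open>(A \<otimes> ev\<^sub>v) f\<^sup>*(b \<otimes> \<phi>) = (\<phi> \<otimes> A) f(v \<otimes> b)\<close>; the sum over a basis of \<open>A\<close> is merely the coordinate
  expansion of this identity, and its finitely many non-zero summands are those needed for the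
  finitely many vectors of a basis of \<open>V\<close> (\<open>dual_value_slice\<close>, \<open>dual_coaction_transpose\<close>).

  Dualising reverses the order of two successive coactions: on \<open>v \<otimes> b \<otimes> c\<close> the axioms for \<open>V\<close> let
  \<open>f\<close> act on \<open>c\<close> by \<open>f\<^sup>1\<^sup>3\<close> and then on \<open>b\<close> by \<open>f \<otimes> A\<close>, whereas on \<open>b \<otimes> c \<otimes> \<phi>\<close> the axioms for \<open>V\<^sup>*\<close>
  let \<open>f\<^sup>*\<close> act on \<open>b\<close> by \<open>(f\<^sup>*)\<^sup>1\<^sup>3\<close> and then on \<open>c\<close> by \<open>A \<otimes> f\<^sup>*\<close>. Thus, for \<open>x \<in> A \<otimes> A\<close>,
  \<open>(A \<otimes> A \<otimes> ev\<^sub>v) (A \<otimes> f\<^sup>*) (f\<^sup>*)\<^sup>1\<^sup>3 (x \<otimes> \<phi>) = (\<phi> \<otimes> A \<otimes> A) (f \<otimes> A) f\<^sup>1\<^sup>3 (v \<otimes> x)\<close>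
  (\<open>transpose_slice_leg23_leg13\<close>). Hence precomposing the left hand composite with a map acting on
  \<open>x\<close> amounts to precomposing the right hand one with it: for \<open>E\<^sub>1\<close> the axiom of the right comodule
  \<open>V\<close> becomes that of the left comodule \<open>V\<^sup>*\<close> (\<open>transpose_coaction_absorbs\<close>), and for \<open>T\<^sub>1\<close> one needs
  in addition that slicing commutes with maps on the remaining tensor factors
  (\<open>transpose_coaction_coassociative\<close>). The compatibility of \<open>\<lambda>\<^sup>*\<close> and \<open>\<rho>\<^sup>*\<close> is obtained slice by slice
  from that of \<open>\<lambda>\<close> and \<open>\<rho>\<close> (\<open>transpose_compatible\<close>).
\<close>


section \<open>Linear maps\<close>

lemma hom_closed: "f \<in> module_hom K M N \<Longrightarrow> x \<in> carrier M \<Longrightarrow> f x \<in> carrier N"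
  by (auto simp: module_hom_def)

lemma hom_compose:
  "f \<in> module_hom K M N \<Longrightarrow> g \<in> module_hom K N P \<Longrightarrow> (\<lambda>x. g (f x)) \<in> module_hom K M P"
  by (auto simp: module_hom_def Pi_iff)

lemma hom_id: "(\<lambda>x. x) \<in> module_hom K M M"
  by (auto simp: module_hom_def)

lemma hom_cong:
  assumes M: "module K M" and f: "f \<in> module_hom K M N" and eq: "\<And>x. x \<in> carrier M \<Longrightarrow> g x = f x"
  shows "g \<in> module_hom K M N"
proof -
  interpret M: module K M by fact
  show ?thesis using f by (auto simp: module_hom_def eq)
qed

lemma hom_zero:
  assumes "module K M" "module K N" "f \<in> module_hom K M N"
  shows "f \<zero>\<^bsub>M\<^esub> = \<zero>\<^bsub>N\<^esub>"
proof -
  interpret f: mod_hom K M N f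
    using assms by (simp add: mod_hom_def mod_hom_axioms_def)
  show ?thesis by simp
qed

lemma hom_add:
  assumes N: "module K N" and f: "f \<in> module_hom K M N" and g: "g \<in> module_hom K M N"
  shows "(\<lambda>x. f x \<oplus>\<^bsub>N\<^esub> g x) \<in> module_hom K M N"
proof -
  interpret N: module K N by fact
  show ?thesis using f g
    by (auto simp: module_hom_def Pi_iff N.smult_r_distr N.M.a_ac)
qed

lemma hom_smult:
  assumes N: "module K N" and f: "f \<in> module_hom K M N" and r: "r \<in> carrier K"
  shows "(\<lambda>x. r \<odot>\<^bsub>N\<^esub> f x) \<in> module_hom K M N"
proof -
  interpret N: module K N by fact
  show ?thesis using f r
    by (auto simp: module_hom_def Pi_iff N.smult_r_distr N.R.m_comm simp flip: N.smult_assoc1)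
qed

lemma hom_finsum:
  assumes M: "module K M" and N: "module K N" and J: "finite J"
    and h: "\<And>i. i \<in> J \<Longrightarrow> h i \<in> module_hom K M N"
  shows "(\<lambda>x. \<Oplus>\<^bsub>N\<^esub>i\<in>J. h i x) \<in> module_hom K M N"
  using J h
proof (induction J)
  case empty
  interpret N: module K N by fact
  show ?case by (auto simp: module_hom_def)
next
  case (insert j J)
  interpret N: module K N by fact
  show ?case
  proof (rule hom_cong[OF M])
    show "(\<lambda>x. h j x \<oplus>\<^bsub>N\<^esub> (\<Oplus>\<^bsub>N\<^esub>i\<in>J. h i x)) \<in> module_hom K M N"
      by (intro hom_add N insert.IH) (auto intro: insert.prems)
    show "(\<Oplus>\<^bsub>N\<^esub>i\<in>insert j J. h i x) = h j x \<oplus>\<^bsub>N\<^esub> (\<Oplus>\<^bsub>N\<^esub>i\<in>J. h i x)" if "x \<in> carrier M" for x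
      using insert that by (intro N.M.finsum_insert) (auto intro: hom_closed)
  qed
qed

lemma hom_apply_finsum:
  assumes M: "module K M" and N: "module K N" and J: "finite J"
    and f: "f \<in> module_hom K M N" and g: "\<And>i. i \<in> J \<Longrightarrow> g i \<in> carrier M"
  shows "f (\<Oplus>\<^bsub>M\<^esub>i\<in>J. g i) = (\<Oplus>\<^bsub>N\<^esub>i\<in>J. f (g i))"
  using J g
proof (induction J)
  case empty
  interpret M: module K M by fact
  interpret N: module K N by fact
  show ?case using hom_zero[OF M N f] by simp
next
  case (insert j J)
  interpret M: module K M by fact
  interpret N: module K N by fact
  have "f (\<Oplus>\<^bsub>M\<^esub>i\<in>insert j J. g i) = f (g j \<oplus>\<^bsub>M\<^esub> (\<Oplus>\<^bsub>M\<^esub>i\<in>J. g i))"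
    using insert by (subst M.M.finsum_insert) auto
  also have "\<dots> = f (g j) \<oplus>\<^bsub>N\<^esub> (\<Oplus>\<^bsub>N\<^esub>i\<in>J. f (g i))"
    using insert by (subst module_hom_add[OF f]) auto
  also have "\<dots> = (\<Oplus>\<^bsub>N\<^esub>i\<in>insert j J. f (g i))"
    using insert f by (intro N.M.finsum_insert[symmetric]) (auto intro: hom_closed)
  finally show ?case .
qed


section \<open>Maps out of tensor products\<close>

lemma bilinear_mapI:
  assumes "\<And>w. w \<in> carrier W \<Longrightarrow> (\<lambda>v. f v w) \<in> module_hom K V U"
    and "\<And>v. v \<in> carrier V \<Longrightarrow> (\<lambda>w. f v w) \<in> module_hom K W U"
  shows "bilinear_map K V W U f"
  using assms unfolding bilinear_map_def module_hom_def by blast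

lemma
  assumes V: "module K V" and W: "module K W"
  shows tensor_closed: "\<And>v w. v \<in> carrier V \<Longrightarrow> w \<in> carrier W
      \<Longrightarrow> tensor K V W v w \<in> carrier (tensor_space K V W)"
    and tensor_linear_left: "\<And>w. w \<in> carrier W
      \<Longrightarrow> (\<lambda>v. tensor K V W v w) \<in> module_hom K V (tensor_space K V W)"
    and tensor_linear_right: "\<And>v. v \<in> carrier V
      \<Longrightarrow> (\<lambda>w. tensor K V W v w) \<in> module_hom K W (tensor_space K V W)"
  using tensor_bilinear_map[OF V W] by (simp_all add: bilinear_map_def module_hom_def)

text \<open>The uniqueness half of the universal property; nearly every identity between maps on tensor
  products below is reduced by it to elementary tensors.\<close>

lemma tensor_hom_ext:
  assumes V: "module K V" and W: "module K W" and U: "module K U"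
    and h: "h \<in> module_hom K (tensor_space K V W) U"
    and h': "h' \<in> module_hom K (tensor_space K V W) U"
    and eq: "\<And>v w. v \<in> carrier V \<Longrightarrow> w \<in> carrier W
      \<Longrightarrow> h (tensor K V W v w) = h' (tensor K V W v w)"
    and x: "x \<in> carrier (tensor_space K V W)"
  shows "h x = h' x"
proof -
  let ?T = "tensor_space K V W"
  interpret T: module K ?T by (rule module_tensor_space[OF V W])
  have r: "restrict g (carrier ?T) \<in> module_hom K ?T U" if "g \<in> module_hom K ?T U" for g
    using that by (auto simp: module_hom_def)
  have "bilinear_map K V W U (\<lambda>v w. h (tensor K V W v w))"
    by (intro bilinear_mapI hom_compose[OF tensor_linear_left h] hom_compose[OF tensor_linear_right h] V W)
  then have "\<exists>!g. g \<in> module_hom K ?T U \<and> g \<in> extensional (carrier ?T)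
      \<and> (\<forall>v\<in>carrier V. \<forall>w\<in>carrier W. g (tensor K V W v w) = h (tensor K V W v w))" (is "\<exists>!g. ?P g")
    by (rule tensor_universal[OF V W U])
  moreover have "?P (restrict h (carrier ?T))" "?P (restrict h' (carrier ?T))"
    using eq r[OF h] r[OF h'] tensor_closed[OF V W] by simp_all
  ultimately have "restrict h (carrier ?T) = restrict h' (carrier ?T)" by blast
  then show ?thesis using x by (metis restrict_apply')
qed

lemma tensor3_hom_ext:
  assumes V: "module K V" and W: "module K W" and Z: "module K Z" and U: "module K U"
    and h: "h \<in> module_hom K (tensor_space K (tensor_space K V W) Z) U"
    and h': "h' \<in> module_hom K (tensor_space K (tensor_space K V W) Z) U"
    and eq: "\<And>v w z. v \<in> carrier V \<Longrightarrow> w \<in> carrier W \<Longrightarrow> z \<in> carrier Z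
      \<Longrightarrow> h (tensor K (tensor_space K V W) Z (tensor K V W v w) z)
        = h' (tensor K (tensor_space K V W) Z (tensor K V W v w) z)"
    and x: "x \<in> carrier (tensor_space K (tensor_space K V W) Z)"
  shows "h x = h' x"
proof (rule tensor_hom_ext[OF _ Z U h h' _ x])
  show VW: "module K (tensor_space K V W)" by (rule module_tensor_space[OF V W])
  fix y z assume y: "y \<in> carrier (tensor_space K V W)" and z: "z \<in> carrier Z"
  note t = tensor_linear_left[OF VW Z z]
  show "h (tensor K (tensor_space K V W) Z y z) = h' (tensor K (tensor_space K V W) Z y z)"
    by (rule tensor_hom_ext[OF V W U hom_compose[OF t h] hom_compose[OF t h'] eq[OF _ _ z] y])
qed

text \<open>For a family of bilinear maps depending linearly on a parameter \<open>p\<close>, linearity in \<open>p\<close> can be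
  checked on elementary tensors \<open>x\<close>. This supplies the bilinearity that is required whenever a
  \<open>tensor_lift\<close> is nested inside another, and the linearity of \<open>\<phi> \<otimes> W\<close> in the functional \<open>\<phi>\<close>.\<close>

lemma tensor_lift_linear_param:
  assumes V: "module K V" and W: "module K W" and U: "module K U" and P: "module K P"
    and f: "\<And>p. p \<in> carrier P \<Longrightarrow> bilinear_map K V W U (f p)"
    and fp: "\<And>v w. v \<in> carrier V \<Longrightarrow> w \<in> carrier W \<Longrightarrow> (\<lambda>p. f p v w) \<in> module_hom K P U"
    and x: "x \<in> carrier (tensor_space K V W)"
  shows "(\<lambda>p. tensor_lift K V W U (f p) x) \<in> module_hom K P U"
proof -
  interpret P: module K P by fact
  note l = tensor_lift_linear[OF V W U f] and t = tensor_lift_tensor[OF V W U f]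
  have "tensor_lift K V W U (f (p \<oplus>\<^bsub>P\<^esub> q)) x
      = tensor_lift K V W U (f p) x \<oplus>\<^bsub>U\<^esub> tensor_lift K V W U (f q) x"
    if p: "p \<in> carrier P" and q: "q \<in> carrier P" for p q
    by (rule tensor_hom_ext[OF V W U l hom_add[OF U l l] _ x])
      (use p q in \<open>simp_all add: t module_hom_add[OF fp]\<close>)
  moreover have "tensor_lift K V W U (f (r \<odot>\<^bsub>P\<^esub> p)) x = r \<odot>\<^bsub>U\<^esub> tensor_lift K V W U (f p) x"
    if p: "p \<in> carrier P" and r: "r \<in> carrier K" for p r
    by (rule tensor_hom_ext[OF V W U l hom_smult[OF U l] _ x])
      (use p r in \<open>simp_all add: t module_hom_smult[OF fp]\<close>)
  ultimately show ?thesis using hom_closed[OF l x] by (auto simp: module_hom_def)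
qed

lemma
  assumes V: "module K V" and W: "module K W" and V': "module K V'" and W': "module K W'"
    and f: "f \<in> module_hom K V V'" and g: "g \<in> module_hom K W W'"
  shows tensor_map_linear:
      "tensor_map K V W V' W' f g \<in> module_hom K (tensor_space K V W) (tensor_space K V' W')"
    and tensor_map_tensor: "\<And>v w. v \<in> carrier V \<Longrightarrow> w \<in> carrier W
      \<Longrightarrow> tensor_map K V W V' W' f g (tensor K V W v w) = tensor K V' W' (f v) (g w)"
proof -
  have b: "bilinear_map K V W (tensor_space K V' W') (\<lambda>v w. tensor K V' W' (f v) (g w))"
    by (intro bilinear_mapI hom_compose[OF f tensor_linear_left] hom_compose[OF g tensor_linear_right]
        V' W' hom_closed[OF f] hom_closed[OF g])
  note l = V W module_tensor_space[OF V' W'] b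
  show "tensor_map K V W V' W' f g \<in> module_hom K (tensor_space K V W) (tensor_space K V' W')"
    unfolding tensor_map_def by (rule tensor_lift_linear[OF l])
  show "\<And>v w. v \<in> carrier V \<Longrightarrow> w \<in> carrier W
      \<Longrightarrow> tensor_map K V W V' W' f g (tensor K V W v w) = tensor K V' W' (f v) (g w)"
    unfolding tensor_map_def by (rule tensor_lift_tensor[OF l])
qed

lemma
  assumes V: "module K V" and W: "module K W"
  shows tensor_flip_linear:
      "tensor_flip K V W \<in> module_hom K (tensor_space K V W) (tensor_space K W V)"
    and tensor_flip_tensor: "\<And>v w. v \<in> carrier V \<Longrightarrow> w \<in> carrier W
      \<Longrightarrow> tensor_flip K V W (tensor K V W v w) = tensor K W V w v"
proof -
  have b: "bilinear_map K V W (tensor_space K W V) (\<lambda>v w. tensor K W V w v)"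
    by (intro bilinear_mapI tensor_linear_left tensor_linear_right V W)
  note l = V W module_tensor_space[OF W V] b
  show "tensor_flip K V W \<in> module_hom K (tensor_space K V W) (tensor_space K W V)"
    unfolding tensor_flip_def by (rule tensor_lift_linear[OF l])
  show "\<And>v w. v \<in> carrier V \<Longrightarrow> w \<in> carrier W
      \<Longrightarrow> tensor_flip K V W (tensor K V W v w) = tensor K W V w v"
    unfolding tensor_flip_def by (rule tensor_lift_tensor[OF l])
qed

lemma
  assumes V: "module K V" and W: "module K W" and Z: "module K Z"
  shows assoc_right_linear: "assoc_right K V W Z \<in> module_hom K
      (tensor_space K (tensor_space K V W) Z) (tensor_space K V (tensor_space K W Z))"
    and assoc_right_tensor: "\<And>v w z. v \<in> carrier V \<Longrightarrow> w \<in> carrier W \<Longrightarrow> z \<in> carrier Z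
      \<Longrightarrow> assoc_right K V W Z (tensor K (tensor_space K V W) Z (tensor K V W v w) z)
        = tensor K V (tensor_space K W Z) v (tensor K W Z w z)"
proof -
  let ?VW = "tensor_space K V W" let ?WZ = "tensor_space K W Z" let ?T = "tensor_space K V ?WZ"
  have VW: "module K ?VW" and WZ: "module K ?WZ" and T: "module K ?T"
    by (intro module_tensor_space V W Z)+
  let ?f = "\<lambda>z v w. tensor K V ?WZ v (tensor K W Z w z)"
  have f: "bilinear_map K V W ?T (?f z)" if z: "z \<in> carrier Z" for z
    by (intro bilinear_mapI tensor_linear_left V WZ tensor_closed W Z z
        hom_compose[OF tensor_linear_left tensor_linear_right])
  have fz: "(\<lambda>z. ?f z v w) \<in> module_hom K Z ?T" if "v \<in> carrier V" "w \<in> carrier W" for v w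
    by (intro hom_compose[OF tensor_linear_right tensor_linear_right] V W Z WZ that)
  have b: "bilinear_map K ?VW Z ?T (\<lambda>x z. tensor_lift K V W ?T (?f z) x)"
    by (intro bilinear_mapI tensor_lift_linear tensor_lift_linear_param V W Z T f fz)
  note l = VW Z T b
  show "assoc_right K V W Z \<in> module_hom K (tensor_space K ?VW Z) ?T"
    unfolding assoc_right_def by (rule tensor_lift_linear[OF l])
  show "assoc_right K V W Z (tensor K ?VW Z (tensor K V W v w) z) = ?f z v w"
    if "v \<in> carrier V" "w \<in> carrier W" "z \<in> carrier Z" for v w z
    unfolding assoc_right_def
    by (simp add: tensor_lift_tensor[OF l] tensor_lift_tensor[OF V W T f] tensor_closed V W that)
qed

lemma
  assumes V: "module K V" and W: "module K W" and Z: "module K Z"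
  shows assoc_left_linear: "assoc_left K V W Z \<in> module_hom K
      (tensor_space K V (tensor_space K W Z)) (tensor_space K (tensor_space K V W) Z)"
    and assoc_left_tensor: "\<And>v w z. v \<in> carrier V \<Longrightarrow> w \<in> carrier W \<Longrightarrow> z \<in> carrier Z
      \<Longrightarrow> assoc_left K V W Z (tensor K V (tensor_space K W Z) v (tensor K W Z w z))
        = tensor K (tensor_space K V W) Z (tensor K V W v w) z"
proof -
  let ?VW = "tensor_space K V W" let ?WZ = "tensor_space K W Z" let ?T = "tensor_space K ?VW Z"
  have VW: "module K ?VW" and WZ: "module K ?WZ" and T: "module K ?T"
    by (intro module_tensor_space V W Z)+
  let ?f = "\<lambda>v w z. tensor K ?VW Z (tensor K V W v w) z"
  have f: "bilinear_map K W Z ?T (?f v)" if v: "v \<in> carrier V" for v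
    by (intro bilinear_mapI tensor_linear_right Z VW tensor_closed V W v
        hom_compose[OF tensor_linear_right tensor_linear_left])
  have fv: "(\<lambda>v. ?f v w z) \<in> module_hom K V ?T" if "w \<in> carrier W" "z \<in> carrier Z" for w z
    by (intro hom_compose[OF tensor_linear_left tensor_linear_left] V W Z VW that)
  have b: "bilinear_map K V ?WZ ?T (\<lambda>v y. tensor_lift K W Z ?T (?f v) y)"
    by (intro bilinear_mapI tensor_lift_linear tensor_lift_linear_param V W Z T f fv)
  note l = V WZ T b
  show "assoc_left K V W Z \<in> module_hom K (tensor_space K V ?WZ) ?T"
    unfolding assoc_left_def tensor3_space_def by (rule tensor_lift_linear[OF l])
  show "assoc_left K V W Z (tensor K V ?WZ v (tensor K W Z w z)) = ?f v w z"
    if "v \<in> carrier V" "w \<in> carrier W" "z \<in> carrier Z" for v w z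
    unfolding assoc_left_def tensor3_space_def
    by (simp add: tensor_lift_tensor[OF l] tensor_lift_tensor[OF W Z T f] tensor_closed W Z that)
qed

text \<open>By this cancellation \<open>Z \<otimes> f\<close> can be computed on \<open>z \<otimes> y\<close> also when \<open>y\<close> is not elementary, as
  happens for \<open>y = E\<^sub>1(b \<otimes> c)\<close> or \<open>y = T\<^sub>1(b \<otimes> c)\<close>.\<close>

lemma assoc_right_assoc_left:
  assumes V: "module K V" and W: "module K W" and Z: "module K Z"
    and v: "v \<in> carrier V" and y: "y \<in> carrier (tensor_space K W Z)"
  shows "assoc_right K V W Z (assoc_left K V W Z (tensor K V (tensor_space K W Z) v y))
    = tensor K V (tensor_space K W Z) v y"
proof -
  have WZ: "module K (tensor_space K W Z)" by (intro module_tensor_space W Z)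
  have T: "module K (tensor_space K V (tensor_space K W Z))" by (intro module_tensor_space V WZ)
  note t = tensor_linear_right[OF V WZ v]
  show ?thesis
    by (rule tensor_hom_ext[OF W Z T _ t _ y],
        rule hom_compose[OF hom_compose[OF t assoc_left_linear[OF V W Z]] assoc_right_linear[OF V W Z]])
      (simp add: assoc_left_tensor[OF V W Z v] assoc_right_tensor[OF V W Z v])
qed


section \<open>Maps acting on two of three tensor factors\<close>

lemma
  assumes V: "module K V" and W: "module K W" and V': "module K V'" and W': "module K W'"
    and Z: "module K Z" and f: "f \<in> module_hom K (tensor_space K V W) (tensor_space K V' W')"
  shows leg12_linear: "leg12 K V W V' W' Z f \<in> module_hom K
      (tensor_space K (tensor_space K V W) Z) (tensor_space K (tensor_space K V' W') Z)"
    and leg12_tensor: "\<And>x z. x \<in> carrier (tensor_space K V W) \<Longrightarrow> z \<in> carrier Z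
      \<Longrightarrow> leg12 K V W V' W' Z f (tensor K (tensor_space K V W) Z x z)
        = tensor K (tensor_space K V' W') Z (f x) z"
  unfolding leg12_def
  by (intro tensor_map_linear tensor_map_tensor module_tensor_space V W V' W' Z f hom_id; assumption)+

lemma
  assumes V: "module K V" and W: "module K W" and V': "module K V'" and W': "module K W'"
    and Z: "module K Z" and f: "f \<in> module_hom K (tensor_space K V W) (tensor_space K V' W')"
  shows leg23_linear: "leg23 K Z V W V' W' f \<in> module_hom K
      (tensor_space K (tensor_space K Z V) W) (tensor_space K (tensor_space K Z V') W')"
    and leg23_assoc_left: "\<And>z y. z \<in> carrier Z \<Longrightarrow> y \<in> carrier (tensor_space K V W)
      \<Longrightarrow> leg23 K Z V W V' W' f (assoc_left K Z V W (tensor K Z (tensor_space K V W) z y))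
        = assoc_left K Z V' W' (tensor K Z (tensor_space K V' W') z (f y))"
proof -
  have VW: "module K (tensor_space K V W)" "module K (tensor_space K V' W')"
    by (intro module_tensor_space V W V' W')+
  note m = tensor_map_linear[OF Z VW(1) Z VW(2) hom_id f]
    and mt = tensor_map_tensor[OF Z VW(1) Z VW(2) hom_id f]
  show "leg23 K Z V W V' W' f \<in> module_hom K
      (tensor_space K (tensor_space K Z V) W) (tensor_space K (tensor_space K Z V') W')"
    unfolding leg23_def comp_def
    by (rule hom_compose[OF hom_compose[OF assoc_right_linear[OF Z V W] m] assoc_left_linear[OF Z V' W']])
  show "\<And>z y. z \<in> carrier Z \<Longrightarrow> y \<in> carrier (tensor_space K V W)
      \<Longrightarrow> leg23 K Z V W V' W' f (assoc_left K Z V W (tensor K Z (tensor_space K V W) z y))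
        = assoc_left K Z V' W' (tensor K Z (tensor_space K V' W') z (f y))"
    unfolding leg23_def comp_def by (simp add: assoc_right_assoc_left[OF Z V W] mt)
qed

lemma leg23_tensor:
  assumes V: "module K V" and W: "module K W" and V': "module K V'" and W': "module K W'"
    and Z: "module K Z" and f: "f \<in> module_hom K (tensor_space K V W) (tensor_space K V' W')"
    and z: "z \<in> carrier Z" and v: "v \<in> carrier V" and w: "w \<in> carrier W"
  shows "leg23 K Z V W V' W' f (tensor K (tensor_space K Z V) W (tensor K Z V z v) w)
    = assoc_left K Z V' W' (tensor K Z (tensor_space K V' W') z (f (tensor K V W v w)))"
  using leg23_assoc_left[OF V W V' W' Z f z tensor_closed[OF V W v w]]
  by (simp add: assoc_left_tensor[OF Z V W z v w])

abbreviation flip23 where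
  "flip23 K V W Z \<equiv> leg23 K V W Z Z W (tensor_flip K W Z)"

lemma
  assumes V: "module K V" and W: "module K W" and Z: "module K Z"
  shows flip23_linear: "flip23 K V W Z \<in> module_hom K
      (tensor_space K (tensor_space K V W) Z) (tensor_space K (tensor_space K V Z) W)"
    and flip23_tensor: "\<And>v w z. v \<in> carrier V \<Longrightarrow> w \<in> carrier W \<Longrightarrow> z \<in> carrier Z
      \<Longrightarrow> flip23 K V W Z (tensor K (tensor_space K V W) Z (tensor K V W v w) z)
        = tensor K (tensor_space K V Z) W (tensor K V Z v z) w"
  using leg23_linear[OF W Z Z W V tensor_flip_linear[OF W Z]]
    leg23_tensor[OF W Z Z W V tensor_flip_linear[OF W Z]]
  by (simp_all add: tensor_flip_tensor[OF W Z] assoc_left_tensor[OF V Z W])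

lemma
  assumes V: "module K V" and W: "module K W" and V': "module K V'" and W': "module K W'"
    and Z: "module K Z" and f: "f \<in> module_hom K (tensor_space K V W) (tensor_space K V' W')"
  shows leg13_linear: "leg13 K V Z W V' W' f \<in> module_hom K
      (tensor_space K (tensor_space K V Z) W) (tensor_space K (tensor_space K V' Z) W')"
    and leg13_tensor: "\<And>v z w. v \<in> carrier V \<Longrightarrow> z \<in> carrier Z \<Longrightarrow> w \<in> carrier W
      \<Longrightarrow> leg13 K V Z W V' W' f (tensor K (tensor_space K V Z) W (tensor K V Z v z) w)
        = flip23 K V' W' Z (tensor K (tensor_space K V' W') Z (f (tensor K V W v w)) z)"
proof -
  note l = leg12_linear[OF V W V' W' Z f]
  show "leg13 K V Z W V' W' f \<in> module_hom K
      (tensor_space K (tensor_space K V Z) W) (tensor_space K (tensor_space K V' Z) W')"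
    unfolding leg13_def comp_def
    by (rule hom_compose[OF hom_compose[OF flip23_linear[OF V Z W] l] flip23_linear[OF V' W' Z]])
  show "\<And>v z w. v \<in> carrier V \<Longrightarrow> z \<in> carrier Z \<Longrightarrow> w \<in> carrier W
      \<Longrightarrow> leg13 K V Z W V' W' f (tensor K (tensor_space K V Z) W (tensor K V Z v z) w)
        = flip23 K V' W' Z (tensor K (tensor_space K V' W') Z (f (tensor K V W v w)) z)"
    unfolding leg13_def comp_def
    by (simp add: flip23_tensor[OF V Z W] leg12_tensor[OF V W V' W' Z f] tensor_closed[OF V W])
qed


section \<open>Contractions\<close>

lemma self_module_simps:
  "carrier (self_module K) = carrier K" "add (self_module K) = add K"
  "smult (self_module K) = mult K" "zero (self_module K) = zero K"
  by (simp_all add: self_module_def)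

lemma module_self_module:
  assumes "cring K" shows "module K (self_module K)"
proof -
  interpret K: cring K by fact
  show ?thesis
  proof (rule module_criteria)
    show "\<forall>v\<in>carrier (self_module K). \<exists>neg_v\<in>carrier (self_module K).
        v \<oplus>\<^bsub>self_module K\<^esub> neg_v = \<zero>\<^bsub>self_module K\<^esub>"
      unfolding self_module_simps using K.a_inv_closed K.r_neg by blast
  qed (auto simp: self_module_simps K.a_ac K.m_assoc K.l_distr K.r_distr K.cring_axioms)
qed

lemma smult_linear_left:
  assumes "module K V" "v \<in> carrier V"
  shows "(\<lambda>c. c \<odot>\<^bsub>V\<^esub> v) \<in> module_hom K (self_module K) V"
proof -
  interpret V: module K V by fact
  show ?thesis using assms(2)
    by (auto simp: module_hom_def self_module_simps V.smult_l_distr V.smult_assoc1)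
qed

lemma
  assumes V: "module K V" and W: "module K W" and p: "\<phi> \<in> module_hom K V (self_module K)"
  shows slice_left_bilinear: "bilinear_map K V W W (\<lambda>v w. \<phi> v \<odot>\<^bsub>W\<^esub> w)"
    and slice_left_linear: "slice_left K V W \<phi> \<in> module_hom K (tensor_space K V W) W"
    and slice_left_tensor: "\<And>v w. v \<in> carrier V \<Longrightarrow> w \<in> carrier W
      \<Longrightarrow> slice_left K V W \<phi> (tensor K V W v w) = \<phi> v \<odot>\<^bsub>W\<^esub> w"
proof -
  show b: "bilinear_map K V W W (\<lambda>v w. \<phi> v \<odot>\<^bsub>W\<^esub> w)"
  proof (rule bilinear_mapI)
    show "(\<lambda>v. \<phi> v \<odot>\<^bsub>W\<^esub> w) \<in> module_hom K V W" if "w \<in> carrier W" for w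
      by (rule hom_compose[OF p smult_linear_left[OF W that]])
    show "(\<lambda>w. \<phi> v \<odot>\<^bsub>W\<^esub> w) \<in> module_hom K W W" if "v \<in> carrier V" for v
      using hom_closed[OF p that] by (intro hom_smult[OF W hom_id]) (simp add: self_module_simps)
  qed
  show "slice_left K V W \<phi> \<in> module_hom K (tensor_space K V W) W"
    unfolding slice_left_def by (rule tensor_lift_linear[OF V W W b])
  show "\<And>v w. v \<in> carrier V \<Longrightarrow> w \<in> carrier W
      \<Longrightarrow> slice_left K V W \<phi> (tensor K V W v w) = \<phi> v \<odot>\<^bsub>W\<^esub> w"
    unfolding slice_left_def by (rule tensor_lift_tensor[OF V W W b])
qed

lemma
  assumes V: "module K V" and W: "module K W" and p: "\<psi> \<in> module_hom K W (self_module K)"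
  shows slice_right_linear: "slice_right K V W \<psi> \<in> module_hom K (tensor_space K V W) V"
    and slice_right_tensor: "\<And>v w. v \<in> carrier V \<Longrightarrow> w \<in> carrier W
      \<Longrightarrow> slice_right K V W \<psi> (tensor K V W v w) = \<psi> w \<odot>\<^bsub>V\<^esub> v"
proof -
  have b: "bilinear_map K V W V (\<lambda>v w. \<psi> w \<odot>\<^bsub>V\<^esub> v)"
  proof (rule bilinear_mapI)
    show "(\<lambda>w. \<psi> w \<odot>\<^bsub>V\<^esub> v) \<in> module_hom K W V" if "v \<in> carrier V" for v
      by (rule hom_compose[OF p smult_linear_left[OF V that]])
    show "(\<lambda>v. \<psi> w \<odot>\<^bsub>V\<^esub> v) \<in> module_hom K V V" if "w \<in> carrier W" for w
      using hom_closed[OF p that] by (intro hom_smult[OF V hom_id]) (simp add: self_module_simps)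
  qed
  show "slice_right K V W \<psi> \<in> module_hom K (tensor_space K V W) V"
    unfolding slice_right_def by (rule tensor_lift_linear[OF V W V b])
  show "\<And>v w. v \<in> carrier V \<Longrightarrow> w \<in> carrier W
      \<Longrightarrow> slice_right K V W \<psi> (tensor K V W v w) = \<psi> w \<odot>\<^bsub>V\<^esub> v"
    unfolding slice_right_def by (rule tensor_lift_tensor[OF V W V b])
qed

text \<open>A coefficient of \<open>f\<^sup>*\<close> is thereby a coordinate of an element of \<open>A\<close>, which brings in the
  expansion of that element in the basis of \<open>A\<close>.\<close>

lemma tensor_functional_slice_left:
  assumes V: "module K V" and W: "module K W"
    and p: "\<phi> \<in> module_hom K V (self_module K)" and q: "\<psi> \<in> module_hom K W (self_module K)"
    and x: "x \<in> carrier (tensor_space K V W)"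
  shows "tensor_functional K V W \<phi> \<psi> x = \<psi> (slice_left K V W \<phi> x)"
proof -
  interpret V: module K V by fact
  have S: "module K (self_module K)" by (rule module_self_module[OF V.R.cring_axioms])
  have b: "bilinear_map K V W (self_module K) (\<lambda>v w. \<phi> v \<otimes>\<^bsub>K\<^esub> \<psi> w)"
  proof (rule bilinear_mapI)
    show "(\<lambda>v. \<phi> v \<otimes>\<^bsub>K\<^esub> \<psi> w) \<in> module_hom K V (self_module K)" if "w \<in> carrier W" for w
      using hom_compose[OF p smult_linear_left[OF S hom_closed[OF q that]]] by (simp add: self_module_simps)
    show "(\<lambda>w. \<phi> v \<otimes>\<^bsub>K\<^esub> \<psi> w) \<in> module_hom K W (self_module K)" if "v \<in> carrier V" for v
      using hom_smult[OF S q] hom_closed[OF p that] by (simp add: self_module_simps)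
  qed
  show ?thesis
    unfolding tensor_functional_def
    by (rule tensor_hom_ext[OF V W S tensor_lift_linear[OF V W S b]
          hom_compose[OF slice_left_linear[OF V W p] q] _ x])
      (use hom_closed[OF p] in \<open>simp add: tensor_lift_tensor[OF V W S b] slice_left_tensor[OF V W p]
        module_hom_smult[OF q] self_module_simps\<close>)
qed


section \<open>The dual space\<close>

lemma dual_space_simps:
  assumes "ring K"
  shows "add (dual_space K V) f g = (\<lambda>v\<in>carrier V. f v \<oplus>\<^bsub>K\<^esub> g v)"
    "smult (dual_space K V) c f = (\<lambda>v\<in>carrier V. c \<otimes>\<^bsub>K\<^esub> f v)"
    "zero (dual_space K V) = (\<lambda>v\<in>carrier V. \<zero>\<^bsub>K\<^esub>)"
  using assms by (simp_all add: dual_space_def ring.func_space_def)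

lemma carrier_dual_space:
  "carrier (dual_space K V) = module_hom K V (self_module K) \<inter> extensional (carrier V)"
  by (simp add: dual_space_def)

lemma dual_space_linear: "\<phi> \<in> carrier (dual_space K V) \<Longrightarrow> \<phi> \<in> module_hom K V (self_module K)"
  by (simp add: carrier_dual_space)

lemma restrict_in_dual_space:
  assumes V: "module K V" and f: "f \<in> module_hom K V (self_module K)"
  shows "(\<lambda>v\<in>carrier V. f v) \<in> carrier (dual_space K V)"
  using hom_cong[OF V f, of "\<lambda>v\<in>carrier V. f v"] by (simp add: carrier_dual_space)

text \<open>Functionals are closed under the operations of the space of all functions on the carrier of
  \<open>V\<close>, so the dual space is a submodule of a known module.\<close>

lemma module_dual_space:
  assumes V: "module K V" shows "module K (dual_space K V)"
proof -
  interpret V: module K V by fact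
  interpret F: module K "V.R.func_space (carrier V)" by (rule V.R.func_space_is_module)
  have S: "module K (self_module K)" by (rule module_self_module[OF V.R.cring_axioms])
  interpret S: module K "self_module K" by fact
  note ops = dual_space_simps[OF V.R.ring_axioms]
  have "submodule K (carrier (dual_space K V)) (V.R.func_space (carrier V))"
  proof
    show "carrier (dual_space K V) \<subseteq> carrier (V.R.func_space (carrier V))"
      by (auto simp: carrier_dual_space module_hom_def V.R.func_space_def self_module_simps PiE_def)
  next
    fix f g assume "f \<in> carrier (dual_space K V)" "g \<in> carrier (dual_space K V)"
    then show "f \<oplus>\<^bsub>V.R.func_space (carrier V)\<^esub> g \<in> carrier (dual_space K V)"
      using restrict_in_dual_space[OF V hom_add[OF S, of f V g]]
      by (simp add: dual_space_linear V.R.func_space_def self_module_simps)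
  next
    have "(\<lambda>v. \<zero>\<^bsub>K\<^esub>) \<in> module_hom K V (self_module K)"
      by (auto simp: module_hom_def self_module_simps)
    from restrict_in_dual_space[OF V this]
    show "\<zero>\<^bsub>V.R.func_space (carrier V)\<^esub> \<in> carrier (dual_space K V)"
      by (simp add: V.R.func_space_def)
  next
    fix c f assume "c \<in> carrier K" "f \<in> carrier (dual_space K V)"
    then show "c \<odot>\<^bsub>V.R.func_space (carrier V)\<^esub> f \<in> carrier (dual_space K V)"
      using restrict_in_dual_space[OF V hom_smult[OF S, of f V c]]
      by (simp add: dual_space_linear V.R.func_space_def self_module_simps)
  qed
  from F.submodule_is_module[OF this] show ?thesis
    by (simp add: dual_space_def)
qed

lemma evaluation_linear:
  assumes V: "module K V" and v: "v \<in> carrier V"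
  shows "(\<lambda>\<psi>. \<psi> v) \<in> module_hom K (dual_space K V) (self_module K)"
proof -
  interpret V: module K V by fact
  show ?thesis using v
    by (auto simp: module_hom_def dual_space_simps[OF V.R.ring_axioms] self_module_simps
        dest!: dual_space_linear dest: hom_closed)
qed

lemma slice_left_linear_functional:
  assumes V: "module K V" and W: "module K W" and x: "x \<in> carrier (tensor_space K V W)"
  shows "(\<lambda>\<phi>. slice_left K V W \<phi> x) \<in> module_hom K (dual_space K V) W"
  unfolding slice_left_def
  by (intro tensor_lift_linear_param[OF V W W module_dual_space[OF V] _ _ x] slice_left_bilinear V W
      dual_space_linear hom_compose[OF evaluation_linear smult_linear_left])


section \<open>Finite dimensional spaces\<close>

text \<open>The coordinates of a vector in a finite basis are unique, which makes them linear functionals.\<close>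

lemma finite_dual_basis:
  assumes "vectorspace K V" and "vectorspace.fin_dim K V"
  obtains B \<delta> where "finite B" "B \<subseteq> carrier V" "\<And>p. p \<in> B \<Longrightarrow> \<delta> p \<in> carrier (dual_space K V)"
    "\<And>v. v \<in> carrier V \<Longrightarrow> v = (\<Oplus>\<^bsub>V\<^esub>p\<in>B. \<delta> p v \<odot>\<^bsub>V\<^esub> p)"
proof -
  interpret V: vectorspace K V by fact
  from V.finite_basis_exists[OF assms(2)] obtain B where B: "finite B" "V.basis B" by blast
  then have BV: "B \<subseteq> carrier V" by (simp add: V.basis_def)
  let ?F = "V.R.func_space B"
  interpret F: module K ?F by (rule V.R.func_space_is_module)
  interpret L: mod_hom K ?F V "\<lambda>a. V.lincomb a B" by (rule V.lincomb_is_mod_hom[OF B(1) BV])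
  have F: "carrier ?F = B \<rightarrow>\<^sub>E carrier K" by (simp add: V.R.func_space_def)
  have ex: "\<exists>!a. a \<in> carrier ?F \<and> V.lincomb a B = v" if "v \<in> carrier V" for v
    using V.basis_criterion[OF B(1) BV] B(2) that unfolding F by blast
  define c where "c v = (THE a. a \<in> carrier ?F \<and> V.lincomb a B = v)" for v
  have c: "c v \<in> carrier ?F" "V.lincomb (c v) B = v" if "v \<in> carrier V" for v
    using theI'[OF ex[OF that]] unfolding c_def by blast+
  have uniq: "c v = a" if "a \<in> carrier ?F" "V.lincomb a B = v" for v a
    unfolding c_def by (rule the1_equality) (use ex[of v] L.f_im that in auto)
  have "c \<in> module_hom K V ?F"
    unfolding module_hom_def by (auto intro!: uniq simp: c)
  then have cp: "(\<lambda>v. c v p) \<in> module_hom K V (self_module K)" if "p \<in> B" for p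
    using that by (auto simp: module_hom_def self_module_simps V.R.func_space_def Pi_iff PiE_iff)
  define \<delta> where "\<delta> p = (\<lambda>v\<in>carrier V. c v p)" for p
  show ?thesis
  proof (rule that[of B \<delta>])
    show "\<delta> p \<in> carrier (dual_space K V)" if "p \<in> B" for p
      unfolding \<delta>_def by (rule restrict_in_dual_space[OF V.module_axioms cp[OF that]])
    show "v = (\<Oplus>\<^bsub>V\<^esub>p\<in>B. \<delta> p v \<odot>\<^bsub>V\<^esub> p)" if "v \<in> carrier V" for v
      using c(2)[OF that] that by (simp add: \<delta>_def V.lincomb_def)
  qed (use B BV in auto)
qed

text \<open>With a basis \<open>p\<close> of \<open>V\<close> and dual basis \<open>\<delta>\<^sub>p\<close>, every \<open>y \<in> W \<otimes> V\<^sup>*\<close> equals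
  \<open>\<Sum>\<^sub>p (W \<otimes> ev\<^sub>p) y \<otimes> \<delta>\<^sub>p\<close>: both sides are linear in \<open>y\<close>, and for \<open>y = w \<otimes> \<psi>\<close> this is the expansion
  \<open>\<psi> = \<Sum>\<^sub>p \<psi>(p) \<delta>\<^sub>p\<close>. So the slices recover \<open>y\<close>.\<close>

lemma slices_separate_points:
  assumes W: "module K W" and V: "vectorspace K V" and fd: "vectorspace.fin_dim K V"
    and y: "y \<in> carrier (tensor_space K W (dual_space K V))"
    and y': "y' \<in> carrier (tensor_space K W (dual_space K V))"
    and eq: "\<And>v. v \<in> carrier V \<Longrightarrow> slice_right K W (dual_space K V) (\<lambda>\<psi>. \<psi> v) y
      = slice_right K W (dual_space K V) (\<lambda>\<psi>. \<psi> v) y'"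
  shows "y = y'"
proof -
  let ?D = "dual_space K V" let ?T = "tensor_space K W ?D"
  let ?s = "\<lambda>v. slice_right K W ?D (\<lambda>\<psi>. \<psi> v)"
  interpret V: vectorspace K V by fact
  interpret W: module K W by fact
  note Vm = V.module_axioms
  have D: "module K ?D" by (rule module_dual_space[OF Vm])
  have T: "module K ?T" by (rule module_tensor_space[OF W D])
  have S: "module K (self_module K)" by (rule module_self_module[OF V.R.cring_axioms])
  interpret D: module K ?D by fact
  interpret S: module K "self_module K" by fact
  interpret T: module K ?T by fact
  obtain B \<delta> where B: "finite B" "B \<subseteq> carrier V" and \<delta>: "\<And>p. p \<in> B \<Longrightarrow> \<delta> p \<in> carrier ?D"
    and expansion: "\<And>v. v \<in> carrier V \<Longrightarrow> v = (\<Oplus>\<^bsub>V\<^esub>p\<in>B. \<delta> p v \<odot>\<^bsub>V\<^esub> p)"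
    by (rule finite_dual_basis[OF V fd]) blast
  have val: "\<psi> v \<in> carrier K" if "\<psi> \<in> carrier ?D" "v \<in> carrier V" for \<psi> v
    using hom_closed[OF dual_space_linear that(2)] that(1) by (simp add: self_module_simps)
  have dual_exp: "(\<Oplus>\<^bsub>?D\<^esub>p\<in>B. \<psi> p \<odot>\<^bsub>?D\<^esub> \<delta> p) = \<psi>" (is "?sum = _") if p: "\<psi> \<in> carrier ?D" for \<psi>
  proof (rule extensionalityI[of _ "carrier V"])
    have summand: "\<psi> p \<odot>\<^bsub>?D\<^esub> \<delta> p \<in> carrier ?D" if "p \<in> B" for p
      using that B by (intro D.smult_closed \<delta> val p) auto
    then have "?sum \<in> carrier ?D" by (intro D.M.finsum_closed) auto
    then show "?sum \<in> extensional (carrier V)" by (simp add: carrier_dual_space)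
    show "\<psi> \<in> extensional (carrier V)" using p by (simp add: carrier_dual_space)
    fix v assume v: "v \<in> carrier V"
    have "?sum v = (\<Oplus>\<^bsub>self_module K\<^esub>p\<in>B. (\<psi> p \<odot>\<^bsub>?D\<^esub> \<delta> p) v)"
      by (rule hom_apply_finsum[OF D S B(1) evaluation_linear[OF Vm v] summand])
    also have "\<dots> = (\<Oplus>\<^bsub>self_module K\<^esub>p\<in>B. \<psi> (\<delta> p v \<odot>\<^bsub>V\<^esub> p))"
      using B \<delta> p v
      by (intro S.M.finsum_cong' refl)
        (simp_all add: dual_space_simps[OF V.R.ring_axioms] module_hom_smult[OF dual_space_linear[OF p]]
          self_module_simps subset_iff val V.R.m_comm)
    also have "\<dots> = \<psi> (\<Oplus>\<^bsub>V\<^esub>p\<in>B. \<delta> p v \<odot>\<^bsub>V\<^esub> p)"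
      using B \<delta> v
      by (intro hom_apply_finsum[OF Vm S B(1) dual_space_linear[OF p], symmetric])
        (auto simp: subset_iff val)
    also have "\<dots> = \<psi> v" using expansion[OF v] by simp
    finally show "?sum v = \<psi> v" .
  qed
  have s: "?s p \<in> module_hom K ?T W" if "p \<in> B" for p
    using that B by (intro slice_right_linear W D evaluation_linear Vm) auto
  have t: "?s p (tensor K W ?D w \<psi>) = \<psi> p \<odot>\<^bsub>W\<^esub> w"
    if "p \<in> B" "w \<in> carrier W" "\<psi> \<in> carrier ?D" for p w \<psi>
    using that B by (intro slice_right_tensor W D evaluation_linear Vm) auto
  have R: "(\<lambda>y. \<Oplus>\<^bsub>?T\<^esub>p\<in>B. tensor K W ?D (?s p y) (\<delta> p)) \<in> module_hom K ?T ?T"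
    by (intro hom_finsum T B hom_compose[OF s tensor_linear_left[OF W D]] \<delta>)
  have expand: "(\<Oplus>\<^bsub>?T\<^esub>p\<in>B. tensor K W ?D (?s p y) (\<delta> p)) = y" if "y \<in> carrier ?T" for y
  proof (rule tensor_hom_ext[OF W D T R hom_id _ that])
    fix w \<psi> assume w: "w \<in> carrier W" and p: "\<psi> \<in> carrier ?D"
    have summand: "\<psi> p \<odot>\<^bsub>?D\<^esub> \<delta> p \<in> carrier ?D" if "p \<in> B" for p
      using that B by (intro D.smult_closed \<delta> val p) auto
    have "(\<Oplus>\<^bsub>?T\<^esub>p\<in>B. tensor K W ?D (?s p (tensor K W ?D w \<psi>)) (\<delta> p))
        = (\<Oplus>\<^bsub>?T\<^esub>p\<in>B. tensor K W ?D w (\<psi> p \<odot>\<^bsub>?D\<^esub> \<delta> p))"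
    proof (rule T.M.finsum_cong'[OF refl])
      fix p assume "p \<in> B"
      then show "tensor K W ?D (?s p (tensor K W ?D w \<psi>)) (\<delta> p) = tensor K W ?D w (\<psi> p \<odot>\<^bsub>?D\<^esub> \<delta> p)"
        using B w p val \<delta> module_hom_smult[OF tensor_linear_left[OF W D \<delta>]]
          module_hom_smult[OF tensor_linear_right[OF W D w]] by (auto simp: t subset_iff)
    qed (auto intro: tensor_closed[OF W D w] summand)
    also have "\<dots> = tensor K W ?D w (\<Oplus>\<^bsub>?D\<^esub>p\<in>B. \<psi> p \<odot>\<^bsub>?D\<^esub> \<delta> p)"
      by (rule hom_apply_finsum[OF D T B(1) tensor_linear_right[OF W D w] summand, symmetric])
    also have "\<dots> = tensor K W ?D w \<psi>" by (simp add: dual_exp[OF p])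
    finally show "(\<Oplus>\<^bsub>?T\<^esub>p\<in>B. tensor K W ?D (?s p (tensor K W ?D w \<psi>)) (\<delta> p)) = tensor K W ?D w \<psi>" .
  qed
  have "y = (\<Oplus>\<^bsub>?T\<^esub>p\<in>B. tensor K W ?D (?s p y) (\<delta> p))" by (simp add: expand y)
  also have "\<dots> = (\<Oplus>\<^bsub>?T\<^esub>p\<in>B. tensor K W ?D (?s p y') (\<delta> p))"
    using B eq hom_closed[OF s y'] by (intro T.M.finsum_cong') (auto intro!: tensor_closed W D \<delta>)
  also have "\<dots> = y'" by (simp add: expand y')
  finally show ?thesis .
qed


section \<open>Coordinates with respect to a basis\<close>

text \<open>Functionals that are biorthogonal to a basis are its coordinate functionals, because \<open>x\<close> is a
  finite linear combination of basis vectors. The index set \<open>J\<close> is left free since the sum defining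
  the dual coaction runs over a set that works for all vectors of \<open>V\<close> at once and
  may exceed the support of a single \<open>x\<close>.\<close>

lemma basis_coordinates:
  assumes A: "vectorspace K A" and inj: "inj_on a I" and basis: "vectorspace.basis K A (a ` I)"
    and \<alpha>: "\<And>i. i \<in> I \<Longrightarrow> \<alpha> i \<in> carrier (dual_space K A)"
    and dual: "\<And>i j. i \<in> I \<Longrightarrow> j \<in> I \<Longrightarrow> \<alpha> i (a j) = (if i = j then \<one>\<^bsub>K\<^esub> else \<zero>\<^bsub>K\<^esub>)"
    and x: "x \<in> carrier A"
  shows "finite {i \<in> I. \<alpha> i x \<noteq> \<zero>\<^bsub>K\<^esub>}"
    and "\<And>J. finite J \<Longrightarrow> J \<subseteq> I \<Longrightarrow> {i \<in> I. \<alpha> i x \<odot>\<^bsub>A\<^esub> a i \<noteq> \<zero>\<^bsub>A\<^esub>} \<subseteq> J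
      \<Longrightarrow> (\<Oplus>\<^bsub>A\<^esub>i\<in>J. \<alpha> i x \<odot>\<^bsub>A\<^esub> a i) = x"
proof -
  interpret A: vectorspace K A by fact
  have S: "module K (self_module K)" by (rule module_self_module[OF A.R.cring_axioms])
  interpret S: module K "self_module K" by fact
  have aI: "a i \<in> carrier A" if "i \<in> I" for i using basis that by (auto simp: A.basis_def)
  have "x \<in> A.span (a ` I)" using basis x by (simp add: A.basis_def)
  then obtain c X where X: "finite X" "X \<subseteq> a ` I" "c \<in> X \<rightarrow> carrier K" and x_eq: "x = A.lincomb c X"
    by (auto simp: A.span_def)
  from finite_subset_image[OF X(1,2)] obtain L where L: "L \<subseteq> I" "finite L" "X = a ` L" by blast
  have inj': "inj_on a L" using inj L(1) by (rule inj_on_subset)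
  have cL: "c (a j) \<in> carrier K" if "j \<in> L" for j using X(3) L(3) that by auto
  have x_sum: "x = (\<Oplus>\<^bsub>A\<^esub>j\<in>L. c (a j) \<odot>\<^bsub>A\<^esub> a j)"
    unfolding x_eq A.lincomb_def L(3)
    by (rule A.M.finsum_reindex[OF _ inj']) (use L cL aI in auto)
  have coord: "\<alpha> i x = (if i \<in> L then c (a i) else \<zero>\<^bsub>K\<^esub>)" if i: "i \<in> I" for i
  proof -
    have "\<alpha> i x = (\<Oplus>\<^bsub>self_module K\<^esub>j\<in>L. \<alpha> i (c (a j) \<odot>\<^bsub>A\<^esub> a j))"
      unfolding x_sum
      by (rule hom_apply_finsum[OF A.module_axioms S L(2) dual_space_linear[OF \<alpha>[OF i]]])
        (use L cL aI in auto)
    also have "\<dots> = (\<Oplus>\<^bsub>self_module K\<^esub>j\<in>L. if i = j then c (a j) else \<zero>\<^bsub>self_module K\<^esub>)"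
      using L cL aI i
      by (intro S.M.finsum_cong')
        (auto simp: module_hom_smult[OF dual_space_linear[OF \<alpha>[OF i]]] dual self_module_simps subset_iff)
    also have "\<dots> = (if i \<in> L then c (a i) else \<zero>\<^bsub>K\<^esub>)"
    proof (cases "i \<in> L")
      case True
      then show ?thesis using S.M.finsum_singleton[OF True L(2), of "\<lambda>j. c (a j)"] cL
        by (simp add: self_module_simps)
    next
      case False
      then have "(\<Oplus>\<^bsub>self_module K\<^esub>j\<in>L. if i = j then c (a j) else \<zero>\<^bsub>self_module K\<^esub>)
          = (\<Oplus>\<^bsub>self_module K\<^esub>j\<in>L. \<zero>\<^bsub>self_module K\<^esub>)"
        by (intro S.M.finsum_cong') auto
      with False show ?thesis by (simp add: self_module_simps)
    qed
    finally show ?thesis .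
  qed
  show "finite {i \<in> I. \<alpha> i x \<noteq> \<zero>\<^bsub>K\<^esub>}"
    by (rule finite_subset[OF _ L(2)]) (auto simp: coord split: if_splits)
  fix J assume J: "finite J" "J \<subseteq> I" "{i \<in> I. \<alpha> i x \<odot>\<^bsub>A\<^esub> a i \<noteq> \<zero>\<^bsub>A\<^esub>} \<subseteq> J"
  have closed: "\<alpha> i x \<odot>\<^bsub>A\<^esub> a i \<in> carrier A" if "i \<in> I" for i
    using hom_closed[OF dual_space_linear[OF \<alpha>[OF that]] x] aI[OF that] by (simp add: self_module_simps)
  have "(\<Oplus>\<^bsub>A\<^esub>i\<in>J. \<alpha> i x \<odot>\<^bsub>A\<^esub> a i) = (\<Oplus>\<^bsub>A\<^esub>i\<in>J \<union> L. \<alpha> i x \<odot>\<^bsub>A\<^esub> a i)"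
    by (rule A.M.add.finprod_mono_neutral_cong_left) (use J L closed in auto)
  also have "\<dots> = (\<Oplus>\<^bsub>A\<^esub>i\<in>L. \<alpha> i x \<odot>\<^bsub>A\<^esub> a i)"
  proof (rule A.M.add.finprod_mono_neutral_cong_right)
    show "\<alpha> i x \<odot>\<^bsub>A\<^esub> a i = \<zero>\<^bsub>A\<^esub>" if "i \<in> J \<union> L - L" for i
    proof -
      have i: "i \<in> I" "i \<notin> L" using that J(2) by auto
      show ?thesis using aI[OF i(1)] i(2) by (simp add: coord[OF i(1)])
    qed
  qed (use J L closed in auto)
  also have "\<dots> = (\<Oplus>\<^bsub>A\<^esub>i\<in>L. c (a i) \<odot>\<^bsub>A\<^esub> a i)"
  proof (rule A.M.finsum_cong'[OF refl])
    show "(\<lambda>i. c (a i) \<odot>\<^bsub>A\<^esub> a i) \<in> L \<rightarrow> carrier A" using L cL aI by auto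
    show "\<alpha> i x \<odot>\<^bsub>A\<^esub> a i = c (a i) \<odot>\<^bsub>A\<^esub> a i" if "i \<in> L" for i
      using that L(1) coord[of i] by auto
  qed
  also have "\<dots> = x" by (rule x_sum[symmetric])
  finally show "(\<Oplus>\<^bsub>A\<^esub>i\<in>J. \<alpha> i x \<odot>\<^bsub>A\<^esub> a i) = x" .
qed

section \<open>The dual coaction\<close>

lemma coefficient_linear:
  assumes V: "module K V" and A: "module K A"
    and f: "f \<in> module_hom K (tensor_space K V A) (tensor_space K V A)"
    and \<phi>: "\<phi> \<in> module_hom K V (self_module K)" and b: "b \<in> carrier A"
  shows "(\<lambda>v. slice_left K V A \<phi> (f (tensor K V A v b))) \<in> module_hom K V A"
  by (rule hom_compose[OF hom_compose[OF tensor_linear_left[OF V A b] f] slice_left_linear[OF V A \<phi>]])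

text \<open>Put \<open>x(v) = (\<phi> \<otimes> A) f(v \<otimes> b)\<close>, an element of \<open>A\<close> depending linearly on \<open>v\<close>. The \<open>i\<close>-th coefficient
  is \<open>v \<mapsto> \<alpha>\<^sub>i(x(v))\<close>; it vanishes as soon as it vanishes on a finite basis of \<open>V\<close>, and each of the
  finitely many elements \<open>x(p)\<close> has finitely many non-zero coordinates. The slice at \<open>v\<close> of the sum
  is the expansion of \<open>x(v)\<close> in the basis of \<open>A\<close>.\<close>

lemma
  assumes A: "vectorspace K A" and V: "vectorspace K V" and fd: "vectorspace.fin_dim K V"
    and inj: "inj_on a I" and basis: "vectorspace.basis K A (a ` I)"
    and \<alpha>: "\<And>i. i \<in> I \<Longrightarrow> \<alpha> i \<in> carrier (dual_space K A)"
    and dual: "\<And>i j. i \<in> I \<Longrightarrow> j \<in> I \<Longrightarrow> \<alpha> i (a j) = (if i = j then \<one>\<^bsub>K\<^esub> else \<zero>\<^bsub>K\<^esub>)"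
    and f: "f \<in> module_hom K (tensor_space K V A) (tensor_space K V A)"
    and b: "b \<in> carrier A" and \<phi>: "\<phi> \<in> carrier (dual_space K V)"
  shows dual_coeff_closed: "\<And>i. i \<in> I \<Longrightarrow> dual_coeff K A V f (\<alpha> i) b \<phi> \<in> carrier (dual_space K V)"
    and finite_dual_support: "finite (dual_support K A V I a \<alpha> f b \<phi>)"
    and dual_value_closed:
      "dual_value K A V I a \<alpha> f b \<phi> \<in> carrier (tensor_space K A (dual_space K V))"
    and dual_value_slice: "\<And>v. v \<in> carrier V
      \<Longrightarrow> slice_right K A (dual_space K V) (\<lambda>\<psi>. \<psi> v) (dual_value K A V I a \<alpha> f b \<phi>)
        = slice_left K V A \<phi> (f (tensor K V A v b))"
proof -
  interpret A: vectorspace K A by fact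
  interpret V: vectorspace K V by fact
  note Am = A.module_axioms and Vm = V.module_axioms
  let ?D = "dual_space K V" let ?T = "tensor_space K A ?D"
  let ?J = "dual_support K A V I a \<alpha> f b \<phi>"
  let ?c = "\<lambda>i. dual_coeff K A V f (\<alpha> i) b \<phi>"
  define x where "x v = slice_left K V A \<phi> (f (tensor K V A v b))" for v
  have D: "module K ?D" by (rule module_dual_space[OF Vm])
  have T: "module K ?T" by (rule module_tensor_space[OF Am D])
  have S: "module K (self_module K)" by (rule module_self_module[OF A.R.cring_axioms])
  interpret S: module K "self_module K" by fact
  interpret T: module K ?T by fact
  have x: "x \<in> module_hom K V A"
    unfolding x_def[abs_def] by (rule coefficient_linear[OF Vm Am f dual_space_linear[OF \<phi>] b])
  have aI: "a i \<in> carrier A" if "i \<in> I" for i using basis that by (auto simp: A.basis_def)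
  have xx: "(\<lambda>v. \<alpha> i (x v)) \<in> module_hom K V (self_module K)" if "i \<in> I" for i
    by (rule hom_compose[OF x dual_space_linear[OF \<alpha>[OF that]]])
  have c: "?c i = (\<lambda>v\<in>carrier V. \<alpha> i (x v))" if "i \<in> I" for i
    unfolding dual_coeff_def x_def
    by (intro restrict_ext tensor_functional_slice_left Vm Am dual_space_linear \<phi> \<alpha> that
        hom_closed[OF f] tensor_closed b)
  show c_closed: "?c i \<in> carrier ?D" if "i \<in> I" for i
    unfolding c[OF that] by (rule restrict_in_dual_space[OF Vm xx[OF that]])
  have summand: "dual_summand K A V a \<alpha> f b \<phi> i \<in> carrier ?T" if "i \<in> I" for i
    unfolding dual_summand_def by (rule tensor_closed[OF Am D aI[OF that] c_closed[OF that]])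
  have J: "?J \<subseteq> I" by (auto simp: dual_support_def)
  obtain B \<delta> where B: "finite B" "B \<subseteq> carrier V" and \<delta>: "\<And>p. p \<in> B \<Longrightarrow> \<delta> p \<in> carrier ?D"
    and expansion: "\<And>v. v \<in> carrier V \<Longrightarrow> v = (\<Oplus>\<^bsub>V\<^esub>p\<in>B. \<delta> p v \<odot>\<^bsub>V\<^esub> p)"
    by (rule finite_dual_basis[OF V fd]) blast
  have zero: "?c i = \<zero>\<^bsub>?D\<^esub>" if i: "i \<in> I" and vanish: "\<And>p. p \<in> B \<Longrightarrow> \<alpha> i (x p) = \<zero>\<^bsub>K\<^esub>" for i
    unfolding c[OF i] dual_space_simps[OF A.R.ring_axioms]
  proof (rule restrict_ext)
    fix v assume v: "v \<in> carrier V"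
    have \<delta>v: "\<delta> p v \<in> carrier K" if "p \<in> B" for p
      using hom_closed[OF dual_space_linear[OF \<delta>[OF that]] v] by (simp add: self_module_simps)
    have "\<alpha> i (x v) = \<alpha> i (x (\<Oplus>\<^bsub>V\<^esub>p\<in>B. \<delta> p v \<odot>\<^bsub>V\<^esub> p))" by (simp add: expansion[OF v, symmetric])
    also have "\<dots> = (\<Oplus>\<^bsub>self_module K\<^esub>p\<in>B. \<alpha> i (x (\<delta> p v \<odot>\<^bsub>V\<^esub> p)))"
      using B(2) by (intro hom_apply_finsum[OF Vm S B(1) xx[OF i]] V.smult_closed \<delta>v) auto
    also have "\<dots> = (\<Oplus>\<^bsub>self_module K\<^esub>p\<in>B. \<zero>\<^bsub>self_module K\<^esub>)"
    proof (rule S.M.finsum_cong'[OF refl])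
      show "\<alpha> i (x (\<delta> p v \<odot>\<^bsub>V\<^esub> p)) = \<zero>\<^bsub>self_module K\<^esub>" if "p \<in> B" for p
        using module_hom_smult[OF xx[OF i] \<delta>v[OF that], of p] vanish[OF that] \<delta>v[OF that] B(2) that
        by (auto simp: self_module_simps)
    qed auto
    also have "\<dots> = \<zero>\<^bsub>K\<^esub>" by (simp add: self_module_simps)
    finally show "\<alpha> i (x v) = \<zero>\<^bsub>K\<^esub>" .
  qed
  have xp: "x p \<in> carrier A" if "p \<in> carrier V" for p by (rule hom_closed[OF x that])
  \<comment> \<open>Outside the supports of the finitely many \<open>x(p)\<close> the functional factor of the summand is zero.\<close>
  show fin: "finite ?J"
  proof (rule finite_subset)
    show "?J \<subseteq> (\<Union>p\<in>B. {i \<in> I. \<alpha> i (x p) \<noteq> \<zero>\<^bsub>K\<^esub>})"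
      using zero hom_zero[OF D T tensor_linear_right[OF Am D aI]]
      by (auto simp: dual_support_def dual_summand_def)
    show "finite (\<Union>p\<in>B. {i \<in> I. \<alpha> i (x p) \<noteq> \<zero>\<^bsub>K\<^esub>})"
      using B by (intro finite_UN_I basis_coordinates(1)[OF A inj basis \<alpha> dual] xp) auto
  qed
  show "dual_value K A V I a \<alpha> f b \<phi> \<in> carrier ?T"
    unfolding dual_value_def using J summand by (intro T.M.finsum_closed) auto
  fix v assume v: "v \<in> carrier V"
  note s = slice_right_linear[OF Am D evaluation_linear[OF Vm v]]
  have st: "slice_right K A ?D (\<lambda>\<psi>. \<psi> v) (dual_summand K A V a \<alpha> f b \<phi> i) = \<alpha> i (x v) \<odot>\<^bsub>A\<^esub> a i"
    if "i \<in> I" for i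
    using slice_right_tensor[OF Am D evaluation_linear[OF Vm v] aI[OF that] c_closed[OF that]] v
    by (simp add: dual_summand_def c[OF that])
  have "slice_right K A ?D (\<lambda>\<psi>. \<psi> v) (dual_value K A V I a \<alpha> f b \<phi>)
      = (\<Oplus>\<^bsub>A\<^esub>i\<in>?J. slice_right K A ?D (\<lambda>\<psi>. \<psi> v) (dual_summand K A V a \<alpha> f b \<phi> i))"
    unfolding dual_value_def by (rule hom_apply_finsum[OF T Am fin s]) (use J summand in auto)
  also have "\<dots> = (\<Oplus>\<^bsub>A\<^esub>i\<in>?J. \<alpha> i (x v) \<odot>\<^bsub>A\<^esub> a i)"
    using J aI hom_closed[OF xx v] by (intro A.M.finsum_cong') (auto simp: st subset_iff self_module_simps)
  also have "\<dots> = x v"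
  proof (rule basis_coordinates(2)[OF A inj basis \<alpha> dual xp[OF v] fin J])
    show "{i \<in> I. \<alpha> i (x v) \<odot>\<^bsub>A\<^esub> a i \<noteq> \<zero>\<^bsub>A\<^esub>} \<subseteq> ?J"
      using st hom_zero[OF T Am s] by (auto simp: dual_support_def) metis
  qed
  finally show "slice_right K A ?D (\<lambda>\<psi>. \<psi> v) (dual_value K A V I a \<alpha> f b \<phi>)
      = slice_left K V A \<phi> (f (tensor K V A v b))" by (simp add: x_def)
qed

text \<open>The basis-free description \<open>(A \<otimes> ev\<^sub>v) g(b \<otimes> \<phi>) = (\<phi> \<otimes> A) f(v \<otimes> b)\<close> of \<open>g = f\<^sup>*\<close>, the only
  property of the dual coaction on which the comodule axioms depend.\<close>

definition is_transpose where
  "is_transpose K A V f g \<longleftrightarrow>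
     g \<in> module_hom K (tensor_space K A (dual_space K V)) (tensor_space K A (dual_space K V))
   \<and> (\<forall>v\<in>carrier V. \<forall>b\<in>carrier A. \<forall>\<phi>\<in>carrier (dual_space K V).
        slice_right K A (dual_space K V) (\<lambda>\<psi>. \<psi> v) (g (tensor K A (dual_space K V) b \<phi>))
        = slice_left K V A \<phi> (f (tensor K V A v b)))"

text \<open>The number of summands varies with \<open>b\<close> and \<open>\<phi>\<close>, so bilinearity of \<open>dual_value\<close> is not visible from
  the sum. It holds because every slice of \<open>dual_value\<close> is bilinear in \<open>b\<close> and \<open>\<phi>\<close>.\<close>

lemma
  assumes A: "vectorspace K A" and V: "vectorspace K V" and fd: "vectorspace.fin_dim K V"
    and inj: "inj_on a I" and basis: "vectorspace.basis K A (a ` I)"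
    and \<alpha>: "\<And>i. i \<in> I \<Longrightarrow> \<alpha> i \<in> carrier (dual_space K A)"
    and dual: "\<And>i j. i \<in> I \<Longrightarrow> j \<in> I \<Longrightarrow> \<alpha> i (a j) = (if i = j then \<one>\<^bsub>K\<^esub> else \<zero>\<^bsub>K\<^esub>)"
    and f: "f \<in> module_hom K (tensor_space K V A) (tensor_space K V A)"
  shows dual_coaction_tensor: "\<And>b \<phi>. b \<in> carrier A \<Longrightarrow> \<phi> \<in> carrier (dual_space K V)
      \<Longrightarrow> dual_coaction K A V I a \<alpha> f (tensor K A (dual_space K V) b \<phi>) = dual_value K A V I a \<alpha> f b \<phi>"
    and dual_coaction_transpose: "is_transpose K A V f (dual_coaction K A V I a \<alpha> f)"
proof -
  interpret A: vectorspace K A by fact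
  interpret V: vectorspace K V by fact
  note Am = A.module_axioms and Vm = V.module_axioms
  let ?D = "dual_space K V" let ?T = "tensor_space K A ?D"
  let ?d = "\<lambda>b \<phi>. dual_value K A V I a \<alpha> f b \<phi>"
  have D: "module K ?D" by (rule module_dual_space[OF Vm])
  have T: "module K ?T" by (rule module_tensor_space[OF Am D])
  interpret D: module K ?D by fact
  interpret T: module K ?T by fact
  note closed = dual_value_closed[OF A V fd inj basis \<alpha> dual f]
  note slice = dual_value_slice[OF A V fd inj basis \<alpha> dual f]
  have s: "slice_right K A ?D (\<lambda>\<psi>. \<psi> v) \<in> module_hom K ?T A" if "v \<in> carrier V" for v
    by (intro slice_right_linear Am D evaluation_linear Vm that)
  note sep = slices_separate_points[OF Am V fd]
  have lin_b: "(\<lambda>b. slice_left K V A \<phi> (f (tensor K V A v b))) \<in> module_hom K A A"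
    if "v \<in> carrier V" "\<phi> \<in> carrier ?D" for v \<phi>
    by (rule hom_compose[OF hom_compose[OF tensor_linear_right[OF Vm Am that(1)] f]
          slice_left_linear[OF Vm Am dual_space_linear[OF that(2)]]])
  have lin_\<phi>: "(\<lambda>\<phi>. slice_left K V A \<phi> (f (tensor K V A v b))) \<in> module_hom K ?D A"
    if "v \<in> carrier V" "b \<in> carrier A" for v b
    by (intro slice_left_linear_functional Vm Am hom_closed[OF f] tensor_closed that)
  have bil: "bilinear_map K A ?D ?T ?d"
    unfolding bilinear_map_def
    by (intro conjI ballI closed sep;
        simp add: closed slice module_hom_add[OF s] module_hom_smult[OF s]
          module_hom_add[OF lin_b] module_hom_smult[OF lin_b]
          module_hom_add[OF lin_\<phi>] module_hom_smult[OF lin_\<phi>])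
  show eq: "dual_coaction K A V I a \<alpha> f (tensor K A ?D b \<phi>) = ?d b \<phi>"
    if "b \<in> carrier A" "\<phi> \<in> carrier ?D" for b \<phi>
    unfolding dual_coaction_def by (rule tensor_lift_tensor[OF Am D T bil that])
  show "is_transpose K A V f (dual_coaction K A V I a \<alpha> f)"
    unfolding is_transpose_def
    using tensor_lift_linear[OF Am D T bil] by (simp add: eq slice) (simp add: dual_coaction_def)
qed

section \<open>Slices of composites of dual coactions\<close>

lemma slice_right_assoc_left:
  assumes U: "module K U" and W: "module K W" and D: "module K D"
    and \<psi>: "\<psi> \<in> module_hom K D (self_module K)"
    and u: "u \<in> carrier U" and t: "t \<in> carrier (tensor_space K W D)"
  shows "slice_right K (tensor_space K U W) D \<psi> (assoc_left K U W D (tensor K U (tensor_space K W D) u t))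
    = tensor K U W u (slice_right K W D \<psi> t)"
proof -
  have WD: "module K (tensor_space K W D)" and UW: "module K (tensor_space K U W)"
    by (intro module_tensor_space U W D)+
  show ?thesis
    by (rule tensor_hom_ext[OF W D UW
          hom_compose[OF hom_compose[OF tensor_linear_right[OF U WD u] assoc_left_linear[OF U W D]]
            slice_right_linear[OF UW D \<psi>]]
          hom_compose[OF slice_right_linear[OF W D \<psi>] tensor_linear_right[OF U W u]] _ t])
      (use hom_closed[OF \<psi>] u in \<open>simp add: assoc_left_tensor[OF U W D] slice_right_tensor[OF UW D \<psi>]
        slice_right_tensor[OF W D \<psi>] tensor_closed[OF U W] self_module_simps
        module_hom_smult[OF tensor_linear_right[OF U W]]\<close>)
qed

lemma slice_right_tensor_map:
  assumes U: "module K U" and W: "module K W" and D: "module K D"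
    and \<psi>: "\<psi> \<in> module_hom K D (self_module K)" and g: "g \<in> module_hom K U W"
    and t: "t \<in> carrier (tensor_space K U D)"
  shows "slice_right K W D \<psi> (tensor_map K U D W D g (\<lambda>x. x) t) = g (slice_right K U D \<psi> t)"
  by (rule tensor_hom_ext[OF U D W
        hom_compose[OF tensor_map_linear[OF U D W D g hom_id] slice_right_linear[OF W D \<psi>]]
        hom_compose[OF slice_right_linear[OF U D \<psi>] g] _ t])
    (use hom_closed[OF \<psi>] in \<open>simp add: tensor_map_tensor[OF U D W D g hom_id] hom_closed[OF g]
      slice_right_tensor[OF U D \<psi>] slice_right_tensor[OF W D \<psi>] module_hom_smult[OF g] self_module_simps\<close>)

lemma slice_left_tensor_map:
  assumes V: "module K V" and U: "module K U" and W: "module K W"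
    and \<phi>: "\<phi> \<in> module_hom K V (self_module K)" and g: "g \<in> module_hom K U W"
    and t: "t \<in> carrier (tensor_space K V U)"
  shows "slice_left K V W \<phi> (tensor_map K V U V W (\<lambda>x. x) g t) = g (slice_left K V U \<phi> t)"
  by (rule tensor_hom_ext[OF V U W
        hom_compose[OF tensor_map_linear[OF V U V W hom_id g] slice_left_linear[OF V W \<phi>]]
        hom_compose[OF slice_left_linear[OF V U \<phi>] g] _ t])
    (use hom_closed[OF \<phi>] in \<open>simp add: tensor_map_tensor[OF V U V W hom_id g] hom_closed[OF g]
      slice_left_tensor[OF V U \<phi>] slice_left_tensor[OF V W \<phi>] module_hom_smult[OF g] self_module_simps\<close>)

lemma slice_right_flip23:
  assumes U: "module K U" and W: "module K W" and D: "module K D"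
    and \<psi>: "\<psi> \<in> module_hom K D (self_module K)"
    and y: "y \<in> carrier (tensor_space K U D)" and w: "w \<in> carrier W"
  shows "slice_right K (tensor_space K U W) D \<psi> (flip23 K U D W (tensor K (tensor_space K U D) W y w))
    = tensor K U W (slice_right K U D \<psi> y) w"
proof -
  have UD: "module K (tensor_space K U D)" and UW: "module K (tensor_space K U W)"
    by (intro module_tensor_space U W D)+
  show ?thesis
    by (rule tensor_hom_ext[OF U D UW
          hom_compose[OF hom_compose[OF tensor_linear_left[OF UD W w] flip23_linear[OF U D W]]
            slice_right_linear[OF UW D \<psi>]]
          hom_compose[OF slice_right_linear[OF U D \<psi>] tensor_linear_left[OF U W w]] _ y])
      (use hom_closed[OF \<psi>] w in \<open>simp add: flip23_tensor[OF U D W] slice_right_tensor[OF UW D \<psi>]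
        slice_right_tensor[OF U D \<psi>] tensor_closed[OF U W] self_module_simps
        module_hom_smult[OF tensor_linear_left[OF U W]]\<close>)
qed

text \<open>An element \<open>z\<close> of \<open>V \<otimes> A\<close> turns \<open>y \<in> W \<otimes> V\<^sup>*\<close> into an element of \<open>W \<otimes> A\<close> by pairing \<open>V\<^sup>*\<close> with \<open>V\<close>.
  For \<open>z = u \<otimes> d\<close> this is the slice of \<open>y\<close> at \<open>u\<close>, tensored with \<open>d\<close>, so knowledge of all slices of
  \<open>y\<close> determines the pairing with an arbitrary \<open>z\<close>. Here \<open>y\<close> is \<open>f\<^sup>*(b \<otimes> \<phi>)\<close>; the slices are all
  that is assumed about it.\<close>

lemma contraction_eq:
  assumes V: "module K V" and A: "module K A" and W: "module K W"
    and f: "f \<in> module_hom K (tensor_space K V W) (tensor_space K V W)"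
    and \<phi>: "\<phi> \<in> module_hom K V (self_module K)" and b: "b \<in> carrier W"
    and y: "y \<in> carrier (tensor_space K W (dual_space K V))"
    and slices: "\<And>u. u \<in> carrier V \<Longrightarrow> slice_right K W (dual_space K V) (\<lambda>\<psi>. \<psi> u) y
      = slice_left K V W \<phi> (f (tensor K V W u b))"
    and z: "z \<in> carrier (tensor_space K V A)"
  shows "tensor_map K W (dual_space K V) W A (\<lambda>x. x) (\<lambda>\<psi>. slice_left K V A \<psi> z) y
    = tensor_map K (tensor_space K V W) A W A (slice_left K V W \<phi>) (\<lambda>x. x)
        (leg12 K V W V W A f (flip23 K V A W (tensor K (tensor_space K V A) W z b)))"
proof -
  let ?D = "dual_space K V"
  have D: "module K ?D" by (rule module_dual_space[OF V])
  have VA: "module K (tensor_space K V A)" and VW: "module K (tensor_space K V W)"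
    and WA: "module K (tensor_space K W A)"
    by (intro module_tensor_space V A W)+
  note sl = slice_left_linear_functional[OF V A]
  have bil: "bilinear_map K W ?D (tensor_space K W A) (\<lambda>x \<psi>. tensor K W A x (slice_left K V A \<psi> z))"
    if z: "z \<in> carrier (tensor_space K V A)" for z
    by (intro bilinear_mapI tensor_linear_left W A hom_closed[OF sl[OF z]]
        hom_compose[OF sl[OF z] tensor_linear_right])
  have lhs: "(\<lambda>z. tensor_map K W ?D W A (\<lambda>x. x) (\<lambda>\<psi>. slice_left K V A \<psi> z) y)
      \<in> module_hom K (tensor_space K V A) (tensor_space K W A)"
    unfolding tensor_map_def
    by (intro tensor_lift_linear_param[OF W D WA VA bil _ y] hom_compose[OF slice_left_linear tensor_linear_right]
        V A W dual_space_linear)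
  have rhs: "(\<lambda>z. tensor_map K (tensor_space K V W) A W A (slice_left K V W \<phi>) (\<lambda>x. x)
        (leg12 K V W V W A f (flip23 K V A W (tensor K (tensor_space K V A) W z b))))
      \<in> module_hom K (tensor_space K V A) (tensor_space K W A)"
    by (rule hom_compose[OF hom_compose[OF hom_compose[OF tensor_linear_left[OF VA W b]
              flip23_linear[OF V A W]] leg12_linear[OF V W V W A f]]
          tensor_map_linear[OF VW A W A slice_left_linear[OF V W \<phi>] hom_id]])
  show ?thesis
  proof (rule tensor_hom_ext[OF V A WA lhs rhs _ z])
    fix u d assume u: "u \<in> carrier V" and d: "d \<in> carrier A"
    note ev = evaluation_linear[OF V u]
    have ud: "tensor K V A u d \<in> carrier (tensor_space K V A)" by (rule tensor_closed[OF V A u d])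
    have "tensor_map K W ?D W A (\<lambda>x. x) (\<lambda>\<psi>. slice_left K V A \<psi> (tensor K V A u d)) y
        = tensor K W A (slice_right K W ?D (\<lambda>\<psi>. \<psi> u) y) d"
    proof (rule tensor_hom_ext[OF W D WA tensor_map_linear[OF W D W A hom_id sl[OF ud]]
          hom_compose[OF slice_right_linear[OF W D ev] tensor_linear_left[OF W A d]] _ y])
      fix w \<psi> assume w: "w \<in> carrier W" and p: "\<psi> \<in> carrier ?D"
      have "\<psi> u \<in> carrier K"
        using hom_closed[OF dual_space_linear[OF p] u] by (simp add: self_module_simps)
      then show "tensor_map K W ?D W A (\<lambda>x. x) (\<lambda>\<psi>. slice_left K V A \<psi> (tensor K V A u d)) (tensor K W ?D w \<psi>)
          = tensor K W A (slice_right K W ?D (\<lambda>\<psi>. \<psi> u) (tensor K W ?D w \<psi>)) d"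
        using w p u d
        by (simp add: tensor_map_tensor[OF W D W A hom_id sl[OF ud]] slice_left_tensor[OF V A dual_space_linear]
            slice_right_tensor[OF W D ev] module_hom_smult[OF tensor_linear_left[OF W A d]]
            module_hom_smult[OF tensor_linear_right[OF W A w]])
    qed
    also have "\<dots> = tensor K W A (slice_left K V W \<phi> (f (tensor K V W u b))) d"
      by (simp add: slices[OF u])
    also have "\<dots> = tensor_map K (tensor_space K V W) A W A (slice_left K V W \<phi>) (\<lambda>x. x)
        (leg12 K V W V W A f (flip23 K V A W (tensor K (tensor_space K V A) W (tensor K V A u d) b)))"
      using u d b hom_closed[OF f tensor_closed[OF V W u b]]
      by (simp add: flip23_tensor[OF V A W] leg12_tensor[OF V W V W A f] tensor_closed[OF V W]
          tensor_map_tensor[OF VW A W A slice_left_linear[OF V W \<phi>] hom_id])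
    finally show "tensor_map K W ?D W A (\<lambda>x. x) (\<lambda>\<psi>. slice_left K V A \<psi> (tensor K V A u d)) y = \<dots>" .
  qed
qed

text \<open>By linearity \<open>x = b \<otimes> c\<close>. On the left, \<open>b\<close> is processed first and \<open>c\<close> second; slicing the second
  step at \<open>v\<close> turns it into the pairing with \<open>f(v \<otimes> c)\<close>. On the right, \<open>f(v \<otimes> c)\<close> is formed first
  and its \<open>V\<close>-component then meets \<open>b\<close>. Both orders agree by \<open>contraction_eq\<close>.\<close>

lemma transpose_slice_leg23_leg13:
  assumes V: "module K V" and A: "module K A"
    and f: "f \<in> module_hom K (tensor_space K V A) (tensor_space K V A)" and g: "is_transpose K A V f g"
    and v: "v \<in> carrier V" and \<phi>: "\<phi> \<in> carrier (dual_space K V)" and x: "x \<in> carrier (tensor_space K A A)"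
  shows "slice_right K (tensor_space K A A) (dual_space K V) (\<lambda>\<psi>. \<psi> v)
      (leg23 K A A (dual_space K V) A (dual_space K V) g
        (leg13 K A A (dual_space K V) A (dual_space K V) g
          (tensor K (tensor_space K A A) (dual_space K V) x \<phi>)))
    = tensor_map K (tensor_space K V A) A A A (slice_left K V A \<phi>) (\<lambda>x. x)
      (leg12 K V A V A A f (leg13 K V A A V A f
        (assoc_left K V A A (tensor K V (tensor_space K A A) v x))))"
proof -
  let ?D = "dual_space K V" let ?AA = "tensor_space K A A"
  have D: "module K ?D" by (rule module_dual_space[OF V])
  have AA: "module K ?AA" and VA: "module K (tensor_space K V A)" and AD: "module K (tensor_space K A ?D)"
    by (intro module_tensor_space V A D)+
  have g_lin: "g \<in> module_hom K (tensor_space K A ?D) (tensor_space K A ?D)"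
    using g by (simp add: is_transpose_def)
  have slice: "slice_right K A ?D (\<lambda>\<psi>. \<psi> u) (g (tensor K A ?D b \<psi>)) = slice_left K V A \<psi> (f (tensor K V A u b))"
    if "u \<in> carrier V" "b \<in> carrier A" "\<psi> \<in> carrier ?D" for u b \<psi>
    using g that by (simp add: is_transpose_def)
  note ev = evaluation_linear[OF V v]
  note \<phi>' = dual_space_linear[OF \<phi>]
  note g23 = leg23_linear[OF A D A D A g_lin] and g13 = leg13_linear[OF A D A D A g_lin]
  show ?thesis
  proof (rule tensor_hom_ext[OF A A AA _ _ _ x])
    show "(\<lambda>x. slice_right K ?AA ?D (\<lambda>\<psi>. \<psi> v)
        (leg23 K A A ?D A ?D g (leg13 K A A ?D A ?D g (tensor K ?AA ?D x \<phi>)))) \<in> module_hom K ?AA ?AA"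
      by (rule hom_compose[OF hom_compose[OF hom_compose[OF tensor_linear_left[OF AA D \<phi>] g13] g23]
            slice_right_linear[OF AA D ev]])
    show "(\<lambda>x. tensor_map K (tensor_space K V A) A A A (slice_left K V A \<phi>) (\<lambda>x. x)
      (leg12 K V A V A A f (leg13 K V A A V A f (assoc_left K V A A (tensor K V ?AA v x)))))
      \<in> module_hom K ?AA ?AA"
      by (rule hom_compose[OF hom_compose[OF hom_compose[OF hom_compose[OF tensor_linear_right[OF V AA v]
                  assoc_left_linear[OF V A A]] leg13_linear[OF V A V A A f]] leg12_linear[OF V A V A A f]]
            tensor_map_linear[OF VA A A A slice_left_linear[OF V A \<phi>'] hom_id]])
    fix b c assume b: "b \<in> carrier A" and c: "c \<in> carrier A"
    let ?y = "g (tensor K A ?D b \<phi>)" and ?z = "f (tensor K V A v c)"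
    have y: "?y \<in> carrier (tensor_space K A ?D)" by (rule hom_closed[OF g_lin tensor_closed[OF A D b \<phi>]])
    have z: "?z \<in> carrier (tensor_space K V A)" by (rule hom_closed[OF f tensor_closed[OF V A v c]])
    have "slice_right K ?AA ?D (\<lambda>\<psi>. \<psi> v) (leg23 K A A ?D A ?D g
          (leg13 K A A ?D A ?D g (tensor K ?AA ?D (tensor K A A b c) \<phi>)))
        = slice_right K ?AA ?D (\<lambda>\<psi>. \<psi> v) (leg23 K A A ?D A ?D g
          (flip23 K A ?D A (tensor K (tensor_space K A ?D) A ?y c)))"
      by (simp add: leg13_tensor[OF A D A D A g_lin b c \<phi>])
    \<comment> \<open>The outer copy of \<open>g\<close>, sliced at \<open>v\<close>, pairs the functional factor of \<open>?y\<close> with \<open>f(v \<otimes> c)\<close>.\<close>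
    also have "\<dots> = tensor_map K A ?D A A (\<lambda>x. x) (\<lambda>\<psi>. slice_left K V A \<psi> ?z) ?y"
    proof (rule tensor_hom_ext[OF A D AA _ _ _ y])
      show "(\<lambda>y. slice_right K ?AA ?D (\<lambda>\<psi>. \<psi> v) (leg23 K A A ?D A ?D g
          (flip23 K A ?D A (tensor K (tensor_space K A ?D) A y c)))) \<in> module_hom K (tensor_space K A ?D) ?AA"
        by (rule hom_compose[OF hom_compose[OF hom_compose[OF tensor_linear_left[OF AD A c]
                  flip23_linear[OF A D A]] g23] slice_right_linear[OF AA D ev]])
      note sl = slice_left_linear_functional[OF V A z]
      show "tensor_map K A ?D A A (\<lambda>x. x) (\<lambda>\<psi>. slice_left K V A \<psi> ?z)
          \<in> module_hom K (tensor_space K A ?D) ?AA"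
        by (rule tensor_map_linear[OF A D A A hom_id sl])
      fix a \<psi> assume a: "a \<in> carrier A" and \<psi>: "\<psi> \<in> carrier ?D"
      show "slice_right K ?AA ?D (\<lambda>\<psi>. \<psi> v) (leg23 K A A ?D A ?D g
          (flip23 K A ?D A (tensor K (tensor_space K A ?D) A (tensor K A ?D a \<psi>) c)))
        = tensor_map K A ?D A A (\<lambda>x. x) (\<lambda>\<psi>. slice_left K V A \<psi> ?z) (tensor K A ?D a \<psi>)"
        using a c \<psi> v
        by (simp add: flip23_tensor[OF A D A] leg23_tensor[OF A D A D A g_lin]
            slice_right_assoc_left[OF A A D ev] hom_closed[OF g_lin tensor_closed[OF A D]] slice
            tensor_map_tensor[OF A D A A hom_id sl])
    qed
    also have "\<dots> = tensor_map K (tensor_space K V A) A A A (slice_left K V A \<phi>) (\<lambda>x. x)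
        (leg12 K V A V A A f (flip23 K V A A (tensor K (tensor_space K V A) A ?z b)))"
      by (rule contraction_eq[OF V A A f \<phi>' b y slice[OF _ b \<phi>] z])
    also have "\<dots> = tensor_map K (tensor_space K V A) A A A (slice_left K V A \<phi>) (\<lambda>x. x)
        (leg12 K V A V A A f (leg13 K V A A V A f (assoc_left K V A A (tensor K V ?AA v (tensor K A A b c)))))"
      by (simp add: assoc_left_tensor[OF V A A v b c] leg13_tensor[OF V A V A A f v b c])
    finally show "slice_right K ?AA ?D (\<lambda>\<psi>. \<psi> v) (leg23 K A A ?D A ?D g
          (leg13 K A A ?D A ?D g (tensor K ?AA ?D (tensor K A A b c) \<phi>))) = \<dots>" .
  qed
qed

lemma slice_left_leg23:
  assumes V: "module K V" and A: "module K A"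
    and T: "T \<in> module_hom K (tensor_space K A A) (tensor_space K A A)"
    and \<phi>: "\<phi> \<in> module_hom K V (self_module K)"
    and x: "x \<in> carrier (tensor_space K (tensor_space K V A) A)"
  shows "tensor_map K (tensor_space K V A) A A A (slice_left K V A \<phi>) (\<lambda>x. x) (leg23 K V A A A A T x)
    = T (tensor_map K (tensor_space K V A) A A A (slice_left K V A \<phi>) (\<lambda>x. x) x)"
proof -
  let ?AA = "tensor_space K A A" let ?s = "tensor_map K (tensor_space K V A) A A A (slice_left K V A \<phi>) (\<lambda>x. x)"
  have AA: "module K ?AA" and VA: "module K (tensor_space K V A)"
    by (intro module_tensor_space V A)+
  interpret AA: module K ?AA by fact
  note s = tensor_map_linear[OF VA A A A slice_left_linear[OF V A \<phi>] hom_id]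
  note st = tensor_map_tensor[OF VA A A A slice_left_linear[OF V A \<phi>] hom_id]
  have \<phi>v: "\<phi> v \<in> carrier K" if "v \<in> carrier V" for v
    using hom_closed[OF \<phi> that] by (simp add: self_module_simps)
  have s_assoc: "?s (assoc_left K V A A (tensor K V ?AA v t)) = \<phi> v \<odot>\<^bsub>?AA\<^esub> t"
    if v: "v \<in> carrier V" and t: "t \<in> carrier ?AA" for v t
    by (rule tensor_hom_ext[OF A A AA hom_compose[OF hom_compose[OF tensor_linear_right[OF V AA v]
              assoc_left_linear[OF V A A]] s] hom_smult[OF AA hom_id \<phi>v[OF v]] _ t])
      (use v in \<open>simp add: assoc_left_tensor[OF V A A] st tensor_closed[OF V A] slice_left_tensor[OF V A \<phi>]
        module_hom_smult[OF tensor_linear_left[OF A A]] \<phi>v\<close>)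
  show ?thesis
  proof (rule tensor3_hom_ext[OF V A A AA hom_compose[OF leg23_linear[OF A A A A V T] s]
        hom_compose[OF s T] _ x])
    fix v a b assume v: "v \<in> carrier V" and a: "a \<in> carrier A" and b: "b \<in> carrier A"
    show "?s (leg23 K V A A A A T (tensor K (tensor_space K V A) A (tensor K V A v a) b))
        = T (?s (tensor K (tensor_space K V A) A (tensor K V A v a) b))"
      using s_assoc[OF v tensor_closed[OF A A a b]]
        s_assoc[OF v hom_closed[OF T tensor_closed[OF A A a b]]]
      by (simp add: leg23_tensor[OF A A A A V T v a b] assoc_left_tensor[OF V A A v a b]
          module_hom_smult[OF T \<phi>v[OF v] tensor_closed[OF A A a b]])
  qed
qed


section \<open>Dualising the comodule axioms\<close>

text \<open>At \<open>v\<close>, the slices of the two sides on \<open>x \<otimes> \<phi>\<close> are the images under \<open>\<phi> \<otimes> A \<otimes> A\<close> of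
  \<open>(f \<otimes> A) f\<^sup>1\<^sup>3\<close> applied to \<open>v \<otimes> E x\<close> and to \<open>v \<otimes> x\<close>.\<close>

lemma transpose_coaction_absorbs:
  assumes A: "module K A" and V: "vectorspace K V" and fd: "vectorspace.fin_dim K V"
    and f: "f \<in> module_hom K (tensor_space K V A) (tensor_space K V A)" and g: "is_transpose K A V f g"
    and E: "E \<in> module_hom K (tensor_space K A A) (tensor_space K A A)"
    and absorb: "\<And>x. x \<in> carrier (tensor_space K (tensor_space K V A) A)
      \<Longrightarrow> leg12 K V A V A A f (leg13 K V A A V A f (leg23 K V A A A A E x))
        = leg12 K V A V A A f (leg13 K V A A V A f x)"
    and y: "y \<in> carrier (tensor_space K (tensor_space K A A) (dual_space K V))"
  shows "leg23 K A A (dual_space K V) A (dual_space K V) g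
      (leg13 K A A (dual_space K V) A (dual_space K V) g (leg12 K A A A A (dual_space K V) E y))
    = leg23 K A A (dual_space K V) A (dual_space K V) g
      (leg13 K A A (dual_space K V) A (dual_space K V) g y)"
proof -
  interpret V: vectorspace K V by fact
  note Vm = V.module_axioms
  let ?D = "dual_space K V" let ?AA = "tensor_space K A A"
  have D: "module K ?D" by (rule module_dual_space[OF Vm])
  have AA: "module K ?AA" and AAD: "module K (tensor_space K ?AA ?D)"
    by (intro module_tensor_space A D)+
  have g_lin: "g \<in> module_hom K (tensor_space K A ?D) (tensor_space K A ?D)"
    using g by (simp add: is_transpose_def)
  note G = hom_compose[OF leg13_linear[OF A D A D A g_lin] leg23_linear[OF A D A D A g_lin]]
  note slice = transpose_slice_leg23_leg13[OF Vm A f g]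
  show ?thesis
  proof (rule tensor_hom_ext[OF AA D AAD hom_compose[OF leg12_linear[OF A A A A D E] G] G _ y])
    fix x \<phi> assume x: "x \<in> carrier ?AA" and \<phi>: "\<phi> \<in> carrier ?D"
    have Ex: "E x \<in> carrier ?AA" by (rule hom_closed[OF E x])
    note t = tensor_closed[OF AA D _ \<phi>]
    have "leg23 K A A ?D A ?D g (leg13 K A A ?D A ?D g (tensor K ?AA ?D (E x) \<phi>))
        = leg23 K A A ?D A ?D g (leg13 K A A ?D A ?D g (tensor K ?AA ?D x \<phi>))"
    proof (rule slices_separate_points[OF AA V fd hom_closed[OF G t[OF Ex]] hom_closed[OF G t[OF x]]])
      fix v assume v: "v \<in> carrier V"
      have "assoc_left K V A A (tensor K V ?AA v x) \<in> carrier (tensor_space K (tensor_space K V A) A)"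
        by (rule hom_closed[OF assoc_left_linear[OF Vm A A] tensor_closed[OF Vm AA v x]])
      from absorb[OF this]
      show "slice_right K ?AA ?D (\<lambda>\<psi>. \<psi> v)
            (leg23 K A A ?D A ?D g (leg13 K A A ?D A ?D g (tensor K ?AA ?D (E x) \<phi>)))
          = slice_right K ?AA ?D (\<lambda>\<psi>. \<psi> v)
            (leg23 K A A ?D A ?D g (leg13 K A A ?D A ?D g (tensor K ?AA ?D x \<phi>)))"
        by (simp add: slice[OF v \<phi> Ex] slice[OF v \<phi> x] leg23_assoc_left[OF A A A A Vm E v x])
    qed
    then show "leg23 K A A ?D A ?D g (leg13 K A A ?D A ?D g (leg12 K A A A A ?D E (tensor K ?AA ?D x \<phi>)))
        = leg23 K A A ?D A ?D g (leg13 K A A ?D A ?D g (tensor K ?AA ?D x \<phi>))"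
      by (simp add: leg12_tensor[OF A A A A D E x \<phi>])
  qed
qed

text \<open>On \<open>x \<otimes> \<phi>\<close> with \<open>x = b \<otimes> c\<close>, the slice of the left hand side is
  \<open>(\<phi> \<otimes> A \<otimes> A) (f \<otimes> A) f\<^sup>1\<^sup>3 (v \<otimes> T x) = (\<phi> \<otimes> A \<otimes> A) (V \<otimes> T) (f(v \<otimes> b) \<otimes> c)\<close>. As \<open>T\<close> and \<open>\<phi>\<close> act on different
  factors, this is \<open>T ((\<phi> \<otimes> A) f(v \<otimes> b) \<otimes> c)\<close>, and the argument of \<open>T\<close> is the slice of \<open>g\<^sup>1\<^sup>3 (x \<otimes> \<phi>)\<close>.
  The single coaction on the right hand side of either axiom is the one acting on \<open>b\<close>, which is
  \<open>\<lambda> \<otimes> A\<close> for a right comodule and \<open>\<lambda>\<^sup>1\<^sup>3\<close> for a left one.\<close>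

lemma transpose_coaction_coassociative:
  assumes A: "module K A" and V: "vectorspace K V" and fd: "vectorspace.fin_dim K V"
    and f: "f \<in> module_hom K (tensor_space K V A) (tensor_space K V A)" and g: "is_transpose K A V f g"
    and T: "T \<in> module_hom K (tensor_space K A A) (tensor_space K A A)"
    and coassoc: "\<And>x. x \<in> carrier (tensor_space K (tensor_space K V A) A)
      \<Longrightarrow> leg12 K V A V A A f (leg13 K V A A V A f (leg23 K V A A A A T x))
        = leg23 K V A A A A T (leg12 K V A V A A f x)"
    and y: "y \<in> carrier (tensor_space K (tensor_space K A A) (dual_space K V))"
  shows "leg23 K A A (dual_space K V) A (dual_space K V) g
      (leg13 K A A (dual_space K V) A (dual_space K V) g (leg12 K A A A A (dual_space K V) T y))
    = leg12 K A A A A (dual_space K V) T (leg13 K A A (dual_space K V) A (dual_space K V) g y)"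
proof -
  interpret V: vectorspace K V by fact
  note Vm = V.module_axioms
  let ?D = "dual_space K V" let ?AA = "tensor_space K A A"
  have D: "module K ?D" by (rule module_dual_space[OF Vm])
  have AA: "module K ?AA" and AAD: "module K (tensor_space K ?AA ?D)"
    and VA: "module K (tensor_space K V A)" and AD: "module K (tensor_space K A ?D)"
    by (intro module_tensor_space A D Vm)+
  have g_lin: "g \<in> module_hom K (tensor_space K A ?D) (tensor_space K A ?D)"
    using g by (simp add: is_transpose_def)
  note g13 = leg13_linear[OF A D A D A g_lin] and T12 = leg12_linear[OF A A A A D T]
  note G = hom_compose[OF g13 leg23_linear[OF A D A D A g_lin]]
  show ?thesis
  proof (rule tensor3_hom_ext[OF A A D AAD hom_compose[OF T12 G] hom_compose[OF g13 T12] _ y])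
    fix b c \<phi> assume b: "b \<in> carrier A" and c: "c \<in> carrier A" and \<phi>: "\<phi> \<in> carrier ?D"
    let ?x = "tensor K A A b c" and ?y = "g (tensor K A ?D b \<phi>)"
    have x: "?x \<in> carrier ?AA" by (rule tensor_closed[OF A A b c])
    have Tx: "T ?x \<in> carrier ?AA" by (rule hom_closed[OF T x])
    have y: "?y \<in> carrier (tensor_space K A ?D)" by (rule hom_closed[OF g_lin tensor_closed[OF A D b \<phi>]])
    have xt: "tensor K ?AA ?D ?x \<phi> \<in> carrier (tensor_space K ?AA ?D)" by (rule tensor_closed[OF AA D x \<phi>])
    have "leg23 K A A ?D A ?D g (leg13 K A A ?D A ?D g (tensor K ?AA ?D (T ?x) \<phi>))
        = leg12 K A A A A ?D T (leg13 K A A ?D A ?D g (tensor K ?AA ?D ?x \<phi>))"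
    proof (rule slices_separate_points[OF AA V fd hom_closed[OF G tensor_closed[OF AA D Tx \<phi>]]
          hom_closed[OF hom_compose[OF g13 T12] xt]])
      fix v assume v: "v \<in> carrier V"
      note ev = evaluation_linear[OF Vm v]
      let ?s = "tensor_map K (tensor_space K V A) A A A (slice_left K V A \<phi>) (\<lambda>x. x)"
      let ?z = "f (tensor K V A v b)"
      have vb: "tensor K V A v b \<in> carrier (tensor_space K V A)" by (rule tensor_closed[OF Vm A v b])
      have z: "?z \<in> carrier (tensor_space K V A)" by (rule hom_closed[OF f vb])
      have w: "assoc_left K V A A (tensor K V ?AA v ?x) \<in> carrier (tensor_space K (tensor_space K V A) A)"
        by (rule hom_closed[OF assoc_left_linear[OF Vm A A] tensor_closed[OF Vm AA v x]])
      have "slice_right K ?AA ?D (\<lambda>\<psi>. \<psi> v)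
            (leg23 K A A ?D A ?D g (leg13 K A A ?D A ?D g (tensor K ?AA ?D (T ?x) \<phi>)))
          = ?s (leg12 K V A V A A f (leg13 K V A A V A f
              (leg23 K V A A A A T (assoc_left K V A A (tensor K V ?AA v ?x)))))"
        by (simp add: transpose_slice_leg23_leg13[OF Vm A f g v \<phi> Tx] leg23_assoc_left[OF A A A A Vm T v x])
      also have "\<dots> = ?s (leg23 K V A A A A T (tensor K (tensor_space K V A) A ?z c))"
        by (simp add: coassoc[OF w]) (simp add: assoc_left_tensor[OF Vm A A v b c] leg12_tensor[OF Vm A Vm A A f vb c])
      also have "\<dots> = T (tensor K A A (slice_left K V A \<phi> ?z) c)"
        using tensor_map_tensor[OF VA A A A slice_left_linear[OF Vm A dual_space_linear[OF \<phi>]] hom_id z c]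
        by (simp add: slice_left_leg23[OF Vm A T dual_space_linear[OF \<phi>] tensor_closed[OF VA A z c]])
      also have "\<dots> = T (slice_right K ?AA ?D (\<lambda>\<psi>. \<psi> v)
          (flip23 K A ?D A (tensor K (tensor_space K A ?D) A ?y c)))"
        using g v b \<phi> by (simp add: slice_right_flip23[OF A A D ev y c] is_transpose_def)
      also have "\<dots> = slice_right K ?AA ?D (\<lambda>\<psi>. \<psi> v)
          (leg12 K A A A A ?D T (leg13 K A A ?D A ?D g (tensor K ?AA ?D ?x \<phi>)))"
        unfolding leg12_def
        using slice_right_tensor_map[OF AA AA D ev T hom_closed[OF g13 xt]]
        by (simp add: leg13_tensor[OF A D A D A g_lin b c \<phi>])
      finally show "slice_right K ?AA ?D (\<lambda>\<psi>. \<psi> v)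
            (leg23 K A A ?D A ?D g (leg13 K A A ?D A ?D g (tensor K ?AA ?D (T ?x) \<phi>))) = \<dots>" .
    qed
    then show "leg23 K A A ?D A ?D g (leg13 K A A ?D A ?D g (leg12 K A A A A ?D T (tensor K ?AA ?D ?x \<phi>)))
        = leg12 K A A A A ?D T (leg13 K A A ?D A ?D g (tensor K ?AA ?D ?x \<phi>))"
      by (simp add: leg12_tensor[OF A A A A D T x \<phi>])
  qed
qed

text \<open>The maps \<open>l\<close> and \<open>r\<close> stand for left and right multiplications. They act on the factor \<open>A\<close>, hence
  commute both with \<open>\<phi> \<otimes> A\<close> and with \<open>A \<otimes> ev\<^sub>v\<close>, and the identity for \<open>f\<close>, \<open>f'\<close> passes to the slices
  of \<open>g\<close>, \<open>g'\<close>.\<close>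

lemma transpose_compatible:
  assumes A: "module K A" and V: "vectorspace K V" and fd: "vectorspace.fin_dim K V"
    and f: "f \<in> module_hom K (tensor_space K V A) (tensor_space K V A)" and g: "is_transpose K A V f g"
    and f': "f' \<in> module_hom K (tensor_space K V A) (tensor_space K V A)" and g': "is_transpose K A V f' g'"
    and l: "l \<in> module_hom K A A" and r: "r \<in> module_hom K A A"
    and a: "a \<in> carrier A" and b: "b \<in> carrier A" and \<phi>: "\<phi> \<in> carrier (dual_space K V)"
    and compat: "\<And>v. v \<in> carrier V \<Longrightarrow> tensor_map K V A V A (\<lambda>w. w) l (f (tensor K V A v b))
      = tensor_map K V A V A (\<lambda>w. w) r (f' (tensor K V A v a))"
  shows "tensor_map K A (dual_space K V) A (dual_space K V) l (\<lambda>w. w) (g (tensor K A (dual_space K V) b \<phi>))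
    = tensor_map K A (dual_space K V) A (dual_space K V) r (\<lambda>w. w) (g' (tensor K A (dual_space K V) a \<phi>))"
proof -
  interpret V: vectorspace K V by fact
  note Vm = V.module_axioms
  let ?D = "dual_space K V"
  have D: "module K ?D" by (rule module_dual_space[OF Vm])
  have gy: "g (tensor K A ?D b \<phi>) \<in> carrier (tensor_space K A ?D)"
    "g' (tensor K A ?D a \<phi>) \<in> carrier (tensor_space K A ?D)"
    using g g' tensor_closed[OF A D _ \<phi>] a b by (auto simp: is_transpose_def intro: hom_closed)
  note \<phi>' = dual_space_linear[OF \<phi>]
  show ?thesis
  proof (rule slices_separate_points[OF A V fd hom_closed[OF tensor_map_linear[OF A D A D l hom_id] gy(1)]
        hom_closed[OF tensor_map_linear[OF A D A D r hom_id] gy(2)]])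
    fix v assume v: "v \<in> carrier V"
    note ev = evaluation_linear[OF Vm v]
    have z: "f (tensor K V A v b) \<in> carrier (tensor_space K V A)"
      "f' (tensor K V A v a) \<in> carrier (tensor_space K V A)"
      using hom_closed[OF f] hom_closed[OF f'] tensor_closed[OF Vm A v] a b by auto
    have "l (slice_left K V A \<phi> (f (tensor K V A v b))) = r (slice_left K V A \<phi> (f' (tensor K V A v a)))"
      unfolding slice_left_tensor_map[OF Vm A A \<phi>' l z(1), symmetric]
        slice_left_tensor_map[OF Vm A A \<phi>' r z(2), symmetric] by (simp add: compat[OF v])
    then show "slice_right K A ?D (\<lambda>\<psi>. \<psi> v) (tensor_map K A ?D A ?D l (\<lambda>w. w) (g (tensor K A ?D b \<phi>)))
        = slice_right K A ?D (\<lambda>\<psi>. \<psi> v) (tensor_map K A ?D A ?D r (\<lambda>w. w) (g' (tensor K A ?D a \<phi>)))"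
      using g g' v a b \<phi>
      by (simp add: slice_right_tensor_map[OF A A D ev l gy(1)] slice_right_tensor_map[OF A A D ev r gy(2)]
          is_transpose_def)
  qed
qed

theorem proposition6p1:
  fixes K :: "('k, 'm) ring_scheme"
    and A :: "('k, 'a, 'n) module_scheme"
    and V :: "('k, 'v, 'l) module_scheme"
    and E1 E2 T1 T2 T3 T4 :: "('a \<times> 'a \<Rightarrow> 'k) set \<Rightarrow> ('a \<times> 'a \<Rightarrow> 'k) set"
    and \<epsilon> :: "'a \<Rightarrow> 'k"
    and lam rho :: "('v \<times> 'a \<Rightarrow> 'k) set \<Rightarrow> ('v \<times> 'a \<Rightarrow> 'k) set"
    and I :: "'i set" and a :: "'i \<Rightarrow> 'a" and \<alpha> :: "'i \<Rightarrow> 'a \<Rightarrow> 'k"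
  assumes "regular_weak_multiplier_bialgebra K A E1 E2 T1 T2 T3 T4 \<epsilon>"
    and "right_comodule K A E1 E2 T1 T2 T3 T4 \<epsilon> V lam rho"
    and "vectorspace.fin_dim K V"
    and "inj_on a I" and "vectorspace.basis K A (a ` I)"
    and "\<And>i. i \<in> I \<Longrightarrow> \<alpha> i \<in> carrier (dual_space K A)"
    and "\<And>i j. i \<in> I \<Longrightarrow> j \<in> I \<Longrightarrow> \<alpha> i (a j) = (if i = j then \<one>\<^bsub>K\<^esub> else \<zero>\<^bsub>K\<^esub>)"
  shows "(\<forall>f\<in>{lam, rho}. \<forall>b\<in>carrier A. \<forall>\<phi>\<in>carrier (dual_space K V).
            (\<forall>i\<in>I. dual_coeff K A V f (\<alpha> i) b \<phi> \<in> carrier (dual_space K V))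
          \<and> finite (dual_support K A V I a \<alpha> f b \<phi>)
          \<and> dual_coaction K A V I a \<alpha> f (tensor K A (dual_space K V) b \<phi>)
            = dual_value K A V I a \<alpha> f b \<phi>)
       \<and> left_comodule K A E1 E2 T1 T2 T3 T4 \<epsilon> (dual_space K V)
            (dual_coaction K A V I a \<alpha> lam) (dual_coaction K A V I a \<alpha> rho)"
proof -
  interpret R: right_comodule K A E1 E2 T1 T2 T3 T4 \<epsilon> V lam rho by (rule assms(2))
  let ?D = "dual_space K V"
  note Am = R.module_axioms and Vm = R.V.module_axioms
  note A = R.vectorspace_axioms and V = R.V.vectorspace_axioms
  have D: "module K ?D" by (rule module_dual_space[OF Vm])
  have Dv: "vectorspace K ?D" using D R.field_axioms by (simp add: vectorspace_def)
  note basis = A V assms(3-7)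
  note lam = R.lam_linear and rho = R.rho_linear
  have f: "f \<in> module_hom K (tensor_space K V A) (tensor_space K V A)" if "f \<in> {lam, rho}" for f
    using that lam rho by blast
  let ?l = "dual_coaction K A V I a \<alpha> lam" and ?r = "dual_coaction K A V I a \<alpha> rho"
  have tl: "is_transpose K A V lam ?l" and tr: "is_transpose K A V rho ?r"
    by (rule dual_coaction_transpose[OF basis lam] dual_coaction_transpose[OF basis rho]; assumption)+
  have "left_comodule K A E1 E2 T1 T2 T3 T4 \<epsilon> ?D ?l ?r"
  proof (intro left_comodule.intro left_comodule_axioms.intro)
    show "regular_weak_multiplier_bialgebra K A E1 E2 T1 T2 T3 T4 \<epsilon>" by (rule assms(1))
    show "vectorspace K ?D" by (rule Dv)
    show "?l \<in> module_hom K (tensor_space K A ?D) (tensor_space K A ?D)"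
      "?r \<in> module_hom K (tensor_space K A ?D) (tensor_space K A ?D)"
      using tl tr by (simp_all add: is_transpose_def)
  next
    fix \<phi> c d assume \<phi>: "\<phi> \<in> carrier ?D" and c: "c \<in> carrier A" and d: "d \<in> carrier A"
    have "(\<lambda>x. c \<otimes>\<^bsub>A\<^esub> x) \<in> module_hom K A A" "(\<lambda>x. x \<otimes>\<^bsub>A\<^esub> d) \<in> module_hom K A A"
      using c d by (auto simp: module_hom_def R.mult_closed R.mult_add_left R.mult_add_right
          R.mult_smult_left R.mult_smult_right)
    from transpose_compatible[OF Am V assms(3) lam tl rho tr this c d \<phi> R.lam_rho[OF _ c d]]
    show "tensor_map K A ?D A ?D (\<lambda>x. c \<otimes>\<^bsub>A\<^esub> x) (\<lambda>w. w) (?l (tensor K A ?D d \<phi>))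
        = tensor_map K A ?D A ?D (\<lambda>x. x \<otimes>\<^bsub>A\<^esub> d) (\<lambda>w. w) (?r (tensor K A ?D c \<phi>))" .
  next
    fix y assume y: "y \<in> carrier (tensor3_space K A A ?D)"
    note y' = y[unfolded tensor3_space_def]
    show "leg23 K A A ?D A ?D ?l (leg13 K A A ?D A ?D ?l (leg12 K A A A A ?D E1 y))
        = leg23 K A A ?D A ?D ?l (leg13 K A A ?D A ?D ?l y)"
      by (rule transpose_coaction_absorbs[OF Am V assms(3) lam tl R.E1_linear
            R.lam_E1[unfolded tensor3_space_def] y'])
    show "leg23 K A A ?D A ?D ?l (leg13 K A A ?D A ?D ?l (leg12 K A A A A ?D T1 y))
        = leg12 K A A A A ?D T1 (leg13 K A A ?D A ?D ?l y)"
      by (rule transpose_coaction_coassociative[OF Am V assms(3) lam tl R.T1_linear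
            R.lam_T1[unfolded tensor3_space_def] y'])
  qed
  then show ?thesis
    using dual_coeff_closed[OF basis f] finite_dual_support[OF basis f] dual_coaction_tensor[OF basis f]
    by simp
qed

end
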